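(* Let $G$ be a simply connected nilpotent Lie group of dimension $n$ equipped with a left-invariant Riemannian metric $h$, and let $\mathfrak{g}$ be its Lie algebra, identified with the space of left-invariant vector fields on $G$. Then the space of left-invariant Killing vector fields on $(G,h)$ coincides with the center $\{\xi\in\mathfrak{g} : [\xi,v]=0 \text{ for all } v\in\mathfrak{g}\}$ of $\mathfrak{g}$.
   Context: The Lie algebra $\mathfrak{g}$ is identified with the space of left-invariant vector fields on $G$ via the canonical isomorphism. A vector field $X$ on a Riemannian manifold $(M,g)$ is a Killing field if $\mathcal{L}_X g=0$, where $\mathcal{L}_X$ is the Lie derivative with respect to $X$. *)

theory Defs
  imports "HOL-Analysis.Analysis" "HOL-Library.Function_Algebras"
begin

text \<open>
  The model space of a manifold is a linear subspace \<open>V\<close> of a Euclidean space, and its dimension is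
  \<open>dim V\<close>. Euclidean spaces as types have positive dimension; allowing subspaces covers dimension
  zero as well (for positive dimension one may take \<open>V = UNIV\<close>).

  In the two definitions below \<open>W\<close> is meant to be relatively open in \<open>V\<close>, so that the restriction
  of the derivative within \<open>W\<close> to the directions in \<open>V\<close> is unique. A function is of class
  \<open>C\<^sup>k\<^sup>+\<^sup>1\<close> if it is Frechet differentiable with all directional derivatives of class \<open>C\<^sup>k\<close>.
\<close>

primrec Ck_on ::
  "nat \<Rightarrow> 'e::euclidean_space set \<Rightarrow> 'e set \<Rightarrow> ('e \<Rightarrow> 'b::real_normed_vector) \<Rightarrow> bool" where
  "Ck_on 0 V W f \<longleftrightarrow> continuous_on W f"
| "Ck_on (Suc k) V W f \<longleftrightarrow>
     (\<exists>f'. (\<forall>x\<in>W. (f has_derivative f' x) (at x within W)) \<and> (\<forall>v\<in>V. Ck_on k V W (\<lambda>x. f' x v)))"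

definition smooth_on ::
  "'e::euclidean_space set \<Rightarrow> 'e set \<Rightarrow> ('e \<Rightarrow> 'b::real_normed_vector) \<Rightarrow> bool" where
  "smooth_on V W f \<longleftrightarrow> (\<forall>k. Ck_on k V W f)"

type_synonym ('m, 'e) chart = "'m set \<times> ('m \<Rightarrow> 'e)"
type_synonym ('m, 'e) atlas = "('m, 'e) chart set"

locale smooth_manifold =
  fixes V :: "'e::euclidean_space set"
    and A :: "('m::{t2_space, second_countable_topology}, 'e) atlas"
  assumes subspace_model: "subspace V"
    and chart_open: "(U, \<phi>) \<in> A \<Longrightarrow> open U"
    and chart_image_open: "(U, \<phi>) \<in> A \<Longrightarrow> openin (top_of_set V) (\<phi> ` U)"
    and chart_homeomorphism: "(U, \<phi>) \<in> A \<Longrightarrow> homeomorphism U (\<phi> ` U) \<phi> (inv_into U \<phi>)"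
    and charts_cover: "(\<Union>(U, \<phi>)\<in>A. U) = UNIV"
    and charts_compatible:
      "(U, \<phi>) \<in> A \<Longrightarrow> (U', \<phi>') \<in> A \<Longrightarrow> smooth_on V (\<phi> ` (U \<inter> U')) (\<phi>' \<circ> inv_into U \<phi>)"

definition smooth_map ::
  "'e::euclidean_space set \<Rightarrow> ('m::topological_space, 'e) atlas \<Rightarrow>
   ('n::topological_space, 'f::euclidean_space) atlas \<Rightarrow> ('m \<Rightarrow> 'n) \<Rightarrow> bool" where
  "smooth_map V A B F \<longleftrightarrow> continuous_on UNIV F \<and>
     (\<forall>(U, \<phi>)\<in>A. \<forall>(U', \<psi>)\<in>B. smooth_on V (\<phi> ` (U \<inter> F -` U')) (\<psi> \<circ> F \<circ> inv_into U \<phi>))"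

text \<open>The product manifold has model space \<open>V \<times> W\<close>.\<close>

definition product_atlas ::
  "('m, 'e) atlas \<Rightarrow> ('n, 'f) atlas \<Rightarrow> ('m \<times> 'n, 'e \<times> 'f) atlas" where
  "product_atlas A B = {(U \<times> U', map_prod \<phi> \<psi>) | U \<phi> U' \<psi>. (U, \<phi>) \<in> A \<and> (U', \<psi>) \<in> B}"

definition smooth_functions ::
  "'e::euclidean_space set \<Rightarrow> ('m::topological_space, 'e) atlas \<Rightarrow> ('m \<Rightarrow> real) set" where
  "smooth_functions V A = {f. \<forall>(U, \<phi>)\<in>A. smooth_on V (\<phi> ` U) (f \<circ> inv_into U \<phi>)}"

text \<open>
  Tangent vectors at \<open>p\<close> are the derivations at \<open>p\<close> of the algebra of smooth functions. As functions
  in HOL are total, a tangent vector is required to vanish on all non-smooth arguments, so that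
  equality of tangent vectors is equality of derivations.
\<close>

type_synonym 'm tangent_vector = "('m \<Rightarrow> real) \<Rightarrow> real"
type_synonym 'm vector_field = "'m \<Rightarrow> 'm tangent_vector"

definition tangent_space ::
  "'e::euclidean_space set \<Rightarrow> ('m::topological_space, 'e) atlas \<Rightarrow> 'm \<Rightarrow> 'm tangent_vector set" where
  "tangent_space V A p = {v.
     (\<forall>f\<in>smooth_functions V A. \<forall>g\<in>smooth_functions V A. v (\<lambda>q. f q + g q) = v f + v g) \<and>
     (\<forall>f\<in>smooth_functions V A. \<forall>c. v (\<lambda>q. c * f q) = c * v f) \<and>
     (\<forall>f\<in>smooth_functions V A. \<forall>g\<in>smooth_functions V A.
        v (\<lambda>q. f q * g q) = f p * v g + g p * v f) \<and>
     (\<forall>f. f \<notin> smooth_functions V A \<longrightarrow> v f = 0)}"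

definition differential ::
  "'e::euclidean_space set \<Rightarrow> ('m::topological_space, 'e) atlas \<Rightarrow> ('n::topological_space \<Rightarrow> 'm) \<Rightarrow>
   'n tangent_vector \<Rightarrow> 'm tangent_vector" where
  "differential V A F v = (\<lambda>f. if f \<in> smooth_functions V A then v (f \<circ> F) else 0)"

definition smooth_vector_fields ::
  "'e::euclidean_space set \<Rightarrow> ('m::topological_space, 'e) atlas \<Rightarrow> 'm vector_field set" where
  "smooth_vector_fields V A = {X. (\<forall>p. X p \<in> tangent_space V A p) \<and>
     (\<forall>f\<in>smooth_functions V A. (\<lambda>p. X p f) \<in> smooth_functions V A)}"

definition lie_bracket :: "'m vector_field \<Rightarrow> 'm vector_field \<Rightarrow> 'm vector_field" where
  "lie_bracket X Y = (\<lambda>p f. X p (\<lambda>q. Y q f) - Y p (\<lambda>q. X q f))"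

type_synonym 'm metric_tensor = "'m \<Rightarrow> 'm tangent_vector \<Rightarrow> 'm tangent_vector \<Rightarrow> real"

definition riemannian_metric ::
  "'e::euclidean_space set \<Rightarrow> ('m::topological_space, 'e) atlas \<Rightarrow> 'm metric_tensor \<Rightarrow> bool" where
  "riemannian_metric V A h \<longleftrightarrow>
     (\<forall>p. \<forall>u\<in>tangent_space V A p. \<forall>v\<in>tangent_space V A p. \<forall>w\<in>tangent_space V A p.
        h p u v = h p v u \<and> h p (u + v) w = h p u w + h p v w) \<and>
     (\<forall>p. \<forall>u\<in>tangent_space V A p. \<forall>v\<in>tangent_space V A p. \<forall>c.
        h p (\<lambda>f. c * u f) v = c * h p u v) \<and>
     (\<forall>p. \<forall>u\<in>tangent_space V A p. u \<noteq> 0 \<longrightarrow> h p u u > 0) \<and>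
     (\<forall>X\<in>smooth_vector_fields V A. \<forall>Y\<in>smooth_vector_fields V A.
        (\<lambda>p. h p (X p) (Y p)) \<in> smooth_functions V A)"

text \<open>
  The Lie derivative along \<open>X\<close> of a (0,2)-tensor field, evaluated on vector fields \<open>Y\<close> and \<open>Z\<close>. It is
  determined by the Leibniz rule
  \<open>X (h (Y, Z)) = (L\<^sub>X h) (Y, Z) + h (L\<^sub>X Y, Z) + h (Y, L\<^sub>X Z)\<close> and \<open>L\<^sub>X Y = [X, Y]\<close>.
\<close>

definition lie_derivative_metric ::
  "'m vector_field \<Rightarrow> 'm metric_tensor \<Rightarrow> 'm vector_field \<Rightarrow> 'm vector_field \<Rightarrow> 'm \<Rightarrow> real" where
  "lie_derivative_metric X h Y Z = (\<lambda>p. X p (\<lambda>q. h q (Y q) (Z q))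
     - h p (lie_bracket X Y p) (Z p) - h p (Y p) (lie_bracket X Z p))"

definition killing_fields ::
  "'e::euclidean_space set \<Rightarrow> ('m::topological_space, 'e) atlas \<Rightarrow> 'm metric_tensor \<Rightarrow>
   'm vector_field set" where
  "killing_fields V A h = {X \<in> smooth_vector_fields V A.
     \<forall>Y\<in>smooth_vector_fields V A. \<forall>Z\<in>smooth_vector_fields V A. lie_derivative_metric X h Y Z = 0}"

locale lie_group = smooth_manifold V A + group mul one ginv
  for V :: "'e::euclidean_space set"
    and A :: "('g::{t2_space, second_countable_topology}, 'e) atlas"
    and mul :: "'g \<Rightarrow> 'g \<Rightarrow> 'g" and one :: 'g and ginv :: "'g \<Rightarrow> 'g" +
  assumes smooth_mul: "smooth_map (V \<times> V) (product_atlas A A) A (\<lambda>(a, b). mul a b)"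
    and smooth_ginv: "smooth_map V A A ginv"

definition left_invariant_fields ::
  "'e::euclidean_space set \<Rightarrow> ('g::topological_space, 'e) atlas \<Rightarrow> ('g \<Rightarrow> 'g \<Rightarrow> 'g) \<Rightarrow>
   'g vector_field set" where
  "left_invariant_fields V A mul = {X \<in> smooth_vector_fields V A.
     \<forall>a p. X (mul a p) = differential V A (mul a) (X p)}"

definition left_invariant_metric ::
  "'e::euclidean_space set \<Rightarrow> ('g::topological_space, 'e) atlas \<Rightarrow> ('g \<Rightarrow> 'g \<Rightarrow> 'g) \<Rightarrow>
   'g metric_tensor \<Rightarrow> bool" where
  "left_invariant_metric V A mul h \<longleftrightarrow>
     (\<forall>a p. \<forall>u\<in>tangent_space V A p. \<forall>v\<in>tangent_space V A p.
        h (mul a p) (differential V A (mul a) u) (differential V A (mul a) v) = h p u v)"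

text \<open>\<open>module.span\<close> is the linear span with respect to the given scalar multiplication.\<close>

primrec lower_central_series ::
  "'e::euclidean_space set \<Rightarrow> ('g::topological_space, 'e) atlas \<Rightarrow> ('g \<Rightarrow> 'g \<Rightarrow> 'g) \<Rightarrow>
   nat \<Rightarrow> 'g vector_field set" where
  "lower_central_series V A mul 0 = left_invariant_fields V A mul"
| "lower_central_series V A mul (Suc k) =
     module.span (\<lambda>(c::real) X p f. c * X p f)
       {lie_bracket X Y | X Y. X \<in> left_invariant_fields V A mul \<and> Y \<in> lower_central_series V A mul k}"

text \<open>
  Nilpotency of a connected Lie group is, as usual in Lie theory, defined through its Lie algebra; it
  is then equivalent to nilpotency of the underlying abstract group.
\<close>

definition nilpotent_lie_group ::
  "'e::euclidean_space set \<Rightarrow> ('g::topological_space, 'e) atlas \<Rightarrow> ('g \<Rightarrow> 'g \<Rightarrow> 'g) \<Rightarrow> bool" where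
  "nilpotent_lie_group V A mul \<longleftrightarrow>
     connected (UNIV :: 'g set) \<and> (\<exists>k. lower_central_series V A mul k = {0})"

end

theory Submission
  imports Defs
begin

text \<open>
  Let \<open>\<xi>\<close> be a left-invariant field and write \<open>ad Y = [\<xi>, Y]\<close>.

  Suppose that \<open>\<xi>\<close> is a Killing field. Inner products of left-invariant fields are constant functions,
  so the Killing equation on left-invariant fields says that \<open>ad\<close> is skew for a positive definite
  form. As \<open>ad\<close> is also nilpotent, it is zero (\<open>killing_imp_central\<close>).

  Conversely, suppose that \<open>\<xi>\<close> is central. The Killing equation has to be verified for arbitrary vector
  fields. In an orthonormal frame of left-invariant fields \<open>E\<close>, which commute with \<open>\<xi>\<close>, the equation for
  \<open>Y = (\<Sum>E. y\<^sub>E * E)\<close> and \<open>Z = (\<Sum>E. z\<^sub>E * E)\<close> becomes the product rule for \<open>\<xi> (\<Sum>E. y\<^sub>E * z\<^sub>E)\<close>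
  (\<open>central_imp_killing\<close>).

  The main work is to obtain such a frame (\<open>left_invariant_frame\<close>), with tangent vectors being
  derivations of the algebra of globally smooth functions. Two facts are needed. First, the tangent
  space is finite-dimensional: Hadamard's lemma and a bump function show that each derivation is a
  directional derivative in a chart (\<open>tangent_vector_is_directional_derivative\<close>), which bounds the
  size of orthonormal systems by the dimension of the model space. Secondly, a tangent vector at the
  identity extends to a smooth left-invariant field (\<open>left_extension_left_invariant\<close>): in charts its
  value on a smooth \<open>f\<close> is a partial derivative of \<open>f\<close> composed with the multiplication.
\<close>

section \<open>Calculus on relatively open subsets of a subspace\<close>

text \<open>
  Automatic unfolding of the successor step of \<open>Ck_on\<close> would introduce a new unspecified derivative
  each time; the two rules below name the derivative explicitly.
\<close>

declare Ck_on.simps(2) [simp del]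

lemma Ck_on_SucE:
  assumes "Ck_on (Suc k) V W f"
  obtains f' where "\<And>x. x \<in> W \<Longrightarrow> (f has_derivative f' x) (at x within W)"
    "\<And>v. v \<in> V \<Longrightarrow> Ck_on k V W (\<lambda>x. f' x v)"
  using assms by (auto simp: Ck_on.simps)

lemma Ck_on_SucI:
  assumes "\<And>x. x \<in> W \<Longrightarrow> (f has_derivative f' x) (at x within W)"
    "\<And>v. v \<in> V \<Longrightarrow> Ck_on k V W (\<lambda>x. f' x v)"
  shows "Ck_on (Suc k) V W f"
  using assms by (auto simp: Ck_on.simps)

lemma Ck_on_cong:
  assumes "Ck_on k V W f" "\<And>x. x \<in> W \<Longrightarrow> g x = f x"
  shows "Ck_on k V W g"
proof (cases k)
  case 0
  then show ?thesis using assms by (auto cong: continuous_on_cong)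
next
  case (Suc j)
  then obtain f' where f': "\<And>x. x \<in> W \<Longrightarrow> (f has_derivative f' x) (at x within W)"
    "\<And>v. v \<in> V \<Longrightarrow> Ck_on j V W (\<lambda>x. f' x v)"
    using assms Ck_on_SucE by blast
  show ?thesis
    unfolding Suc
    by (rule Ck_on_SucI[OF _ f'(2)]) (auto intro: has_derivative_transform[OF _ assms(2) f'(1)])
qed

lemma Ck_on_subset:
  assumes "Ck_on k V W f" "S \<subseteq> W"
  shows "Ck_on k V S f"
  using assms
proof (induction k arbitrary: f)
  case 0
  then show ?case by (auto intro: continuous_on_subset)
next
  case (Suc k)
  then obtain f' where f': "\<And>x. x \<in> W \<Longrightarrow> (f has_derivative f' x) (at x within W)"
    "\<And>v. v \<in> V \<Longrightarrow> Ck_on k V W (\<lambda>x. f' x v)"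
    using Ck_on_SucE by blast
  show ?case
    by (rule Ck_on_SucI[where f' = f'])
      (use f' Suc in \<open>auto intro: has_derivative_subset[OF f'(1) \<open>S \<subseteq> W\<close>]\<close>)
qed

lemma Ck_on_Suc_imp:
  assumes "Ck_on (Suc k) V W f"
  shows "Ck_on k V W f"
  using assms
proof (induction k arbitrary: f)
  case 0
  then show ?case
    by (auto simp: Ck_on.simps continuous_on_eq_continuous_within intro: has_derivative_continuous)
next
  case (Suc k)
  then obtain f' where f': "\<And>x. x \<in> W \<Longrightarrow> (f has_derivative f' x) (at x within W)"
    "\<And>v. v \<in> V \<Longrightarrow> Ck_on (Suc k) V W (\<lambda>x. f' x v)"
    using Ck_on_SucE by blast
  show ?case
    by (rule Ck_on_SucI[where f' = f']) (use f' Suc in auto)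
qed

lemma Ck_on_const: "Ck_on k V W (\<lambda>_. c)"
proof (induction k arbitrary: c)
  case (Suc k)
  show ?case
    by (rule Ck_on_SucI[where f' = "\<lambda>_ _. 0"]) (auto simp: Suc)
qed auto

lemma Ck_on_bounded_linear:
  assumes "bounded_linear L"
  shows "Ck_on k V W L"
proof (cases k)
  case 0
  then show ?thesis using assms by (simp add: linear_continuous_on)
next
  case (Suc j)
  show ?thesis
    unfolding Suc
    by (rule Ck_on_SucI[where f' = "\<lambda>_. L"])
      (auto simp: Ck_on_const assms bounded_linear_imp_has_derivative)
qed

lemma Ck_on_add:
  assumes "Ck_on k V W f" "Ck_on k V W g"
  shows "Ck_on k V W (\<lambda>x. f x + g x)"
  using assms
proof (induction k arbitrary: f g)
  case 0
  then show ?case by (auto intro: continuous_intros)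
next
  case (Suc k)
  obtain f' where f': "\<And>x. x \<in> W \<Longrightarrow> (f has_derivative f' x) (at x within W)"
    "\<And>v. v \<in> V \<Longrightarrow> Ck_on k V W (\<lambda>x. f' x v)"
    using Suc.prems(1) Ck_on_SucE by blast
  obtain g' where g': "\<And>x. x \<in> W \<Longrightarrow> (g has_derivative g' x) (at x within W)"
    "\<And>v. v \<in> V \<Longrightarrow> Ck_on k V W (\<lambda>x. g' x v)"
    using Suc.prems(2) Ck_on_SucE by blast
  show ?case
    by (rule Ck_on_SucI[where f' = "\<lambda>x v. f' x v + g' x v"])
      (use f' g' Suc in \<open>auto intro: has_derivative_add\<close>)
qed

lemma Ck_on_sum:
  assumes "\<And>i. i \<in> I \<Longrightarrow> Ck_on k V W (f i)"
  shows "Ck_on k V W (\<lambda>x. \<Sum>i\<in>I. f i x)"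
  using assms
  by (induction I rule: infinite_finite_induct) (auto intro: Ck_on_const Ck_on_add)

text \<open>
  In the Leibniz rule the derivatives are multiplied by the functions themselves, which by
  monotonicity in \<open>k\<close> may be used at the lower order of the induction hypothesis.
\<close>

lemma Ck_on_bilinear:
  assumes "bounded_bilinear pr" "Ck_on k V W f" "Ck_on k V W g"
  shows "Ck_on k V W (\<lambda>x. pr (f x) (g x))"
  using assms(2,3)
proof (induction k arbitrary: f g)
  case 0
  then show ?case by (auto intro: bounded_bilinear.continuous_on[OF assms(1)])
next
  case (Suc k)
  obtain f' where f': "\<And>x. x \<in> W \<Longrightarrow> (f has_derivative f' x) (at x within W)"
    "\<And>v. v \<in> V \<Longrightarrow> Ck_on k V W (\<lambda>x. f' x v)"
    using Suc.prems(1) Ck_on_SucE by blast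
  obtain g' where g': "\<And>x. x \<in> W \<Longrightarrow> (g has_derivative g' x) (at x within W)"
    "\<And>v. v \<in> V \<Longrightarrow> Ck_on k V W (\<lambda>x. g' x v)"
    using Suc.prems(2) Ck_on_SucE by blast
  show ?case
  proof (rule Ck_on_SucI[where f' = "\<lambda>x v. pr (f x) (g' x v) + pr (f' x v) (g x)"])
    show "Ck_on k V W (\<lambda>x. pr (f x) (g' x v) + pr (f' x v) (g x))" if "v \<in> V" for v
      using that Suc.prems f' g' by (intro Ck_on_add Suc.IH) (auto dest: Ck_on_Suc_imp)
  qed (use f' g' in \<open>auto intro: bounded_bilinear.FDERIV[OF assms(1)]\<close>)
qed

text \<open>
  Since \<open>W \<subseteq> V\<close>, a derivative within \<open>W\<close> may be precomposed with the orthogonal projection onto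
  \<open>V\<close>; this replaces its arbitrary values outside of \<open>V\<close> by combinations of directional derivatives
  along an orthonormal basis, whose regularity is part of the definition.
\<close>

lemma has_derivative_project:
  fixes f :: "'e::euclidean_space \<Rightarrow> 'b::real_normed_vector"
  assumes f: "(f has_derivative f') (at x within W)" and "x \<in> W" "W \<subseteq> V" "subspace V"
    and B: "pairwise orthogonal B" "\<And>b. b \<in> B \<Longrightarrow> norm b = 1" "finite B" "span B = V"
  shows "(f has_derivative (\<lambda>v. \<Sum>b\<in>B. (v \<bullet> b) *\<^sub>R f' b)) (at x within W)"
proof -
  define P where "P v = (\<Sum>b\<in>B. (v \<bullet> b) *\<^sub>R b)" for v
  have P: "P v = v" if "v \<in> V" for v
    unfolding P_def using orthonormal_basis_expand[OF B(1,2)] B that by auto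
  have Q: "x + P (y - x) = y" if "y \<in> W" for y
  proof -
    have "y - x \<in> V" using that assms(2,3,4) by (blast intro: subspace_diff)
    then show ?thesis by (simp add: P)
  qed
  have lin: "linear f'" using f has_derivative_linear by blast
  have "((\<lambda>y. f (x + P (y - x))) has_derivative (\<lambda>v. f' (P v))) (at x within W)"
  proof (rule has_derivative_in_compose[where f = "\<lambda>y. x + P (y - x)" and g = f])
    show "((\<lambda>y. x + P (y - x)) has_derivative P) (at x within W)"
      unfolding P_def by (auto intro!: derivative_eq_intros)
    have "(\<lambda>y. x + P (y - x)) ` W = W" using Q by auto
    then show "(f has_derivative f') (at (x + P (x - x)) within (\<lambda>y. x + P (y - x)) ` W)"
      using f Q[OF \<open>x \<in> W\<close>] by simp
  qed
  then have "(f has_derivative (\<lambda>v. f' (P v))) (at x within W)"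
    by (rule has_derivative_transform[OF \<open>x \<in> W\<close>, rotated]) (simp add: Q)
  moreover have "f' (P v) = (\<Sum>b\<in>B. (v \<bullet> b) *\<^sub>R f' b)" for v
    unfolding P_def by (simp add: linear_sum[OF lin] linear_cmul[OF lin])
  ultimately show ?thesis by simp
qed

text \<open>
  The chain rule gives \<open>g' (f x) (f' x v)\<close>, in which the direction depends on \<open>x\<close>. Expanding that
  direction in an orthonormal basis \<open>B\<close> of \<open>V'\<close> turns it into a sum of products of \<open>f' x v \<bullet> b\<close> with
  \<open>g' (f x) b\<close>, and these factors are of class \<open>C\<^sup>k\<close> by assumption and by induction.
\<close>

lemma Ck_on_compose:
  fixes f :: "'e::euclidean_space \<Rightarrow> 'f::euclidean_space" and g :: "'f \<Rightarrow> 'b::real_normed_vector"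
  assumes "Ck_on k V W f" "Ck_on k V' W' g" "f ` W \<subseteq> W'" "W' \<subseteq> V'" "subspace V'"
  shows "Ck_on k V W (\<lambda>x. g (f x))"
  using assms(1,2)
proof (induction k arbitrary: g)
  case 0
  then show ?case using assms(3) by (auto intro: continuous_on_compose2)
next
  case (Suc k)
  obtain f' where f': "\<And>x. x \<in> W \<Longrightarrow> (f has_derivative f' x) (at x within W)"
    "\<And>v. v \<in> V \<Longrightarrow> Ck_on k V W (\<lambda>x. f' x v)"
    using Suc.prems(1) Ck_on_SucE by blast
  obtain g' where g': "\<And>x. x \<in> W' \<Longrightarrow> (g has_derivative g' x) (at x within W')"
    "\<And>v. v \<in> V' \<Longrightarrow> Ck_on k V' W' (\<lambda>x. g' x v)"
    using Suc.prems(2) Ck_on_SucE by blast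
  obtain B where B: "B \<subseteq> V'" "pairwise orthogonal B" "\<And>b. b \<in> B \<Longrightarrow> norm b = 1"
    "independent B" "span B = V'"
    using orthonormal_basis_subspace[OF assms(5)] by metis
  have fin: "finite B" using B(4) independent_imp_finite by blast
  show ?case
  proof (rule Ck_on_SucI[where f' = "\<lambda>x v. \<Sum>b\<in>B. (f' x v \<bullet> b) *\<^sub>R g' (f x) b"])
    fix x assume x: "x \<in> W"
    then have fx: "f x \<in> W'" using assms(3) by auto
    have "(g has_derivative (\<lambda>v. \<Sum>b\<in>B. (v \<bullet> b) *\<^sub>R g' (f x) b)) (at (f x) within W')"
      using has_derivative_project[OF g'(1)[OF fx] fx assms(4,5) B(2,3) fin B(5)] .
    then have "(g has_derivative (\<lambda>v. \<Sum>b\<in>B. (v \<bullet> b) *\<^sub>R g' (f x) b)) (at (f x) within f ` W)"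
      using assms(3) has_derivative_subset by blast
    then show "((\<lambda>x. g (f x)) has_derivative (\<lambda>v. \<Sum>b\<in>B. (f' x v \<bullet> b) *\<^sub>R g' (f x) b)) (at x within W)"
      using has_derivative_in_compose[OF f'(1)[OF x]] by blast
  next
    fix v assume v: "v \<in> V"
    have "Ck_on k V W (\<lambda>x. f' x v \<bullet> b)" for b
      by (intro Ck_on_bilinear[OF bounded_bilinear_inner] Ck_on_const f'(2) v)
    moreover have "Ck_on k V W (\<lambda>x. g' (f x) b)" if "b \<in> B" for b
      using Suc.IH[OF _ g'(2)] Suc.prems(1) that B(1) by (auto dest: Ck_on_Suc_imp)
    ultimately show "Ck_on k V W (\<lambda>x. \<Sum>b\<in>B. (f' x v \<bullet> b) *\<^sub>R g' (f x) b)"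
      by (intro Ck_on_sum Ck_on_bilinear[OF bounded_bilinear_scaleR])
  qed
qed

text \<open>
  Along a direction \<open>v \<in> V\<close> a point of a relatively open \<open>W\<close> can be moved both ways inside \<open>W\<close>, so
  the derivative within \<open>W\<close> is determined there by the curve \<open>t \<mapsto> x + t v\<close>.
\<close>

lemma has_derivative_within_unique:
  fixes f :: "'e::euclidean_space \<Rightarrow> 'b::real_normed_vector"
  assumes "(f has_derivative D1) (at x within W)" "(f has_derivative D2) (at x within W)"
    and W: "openin (top_of_set V) W" and "subspace V" "x \<in> W" "v \<in> V"
  shows "D1 v = D2 v"
proof -
  obtain T where T: "open T" "W = V \<inter> T" using W by (auto simp: openin_open)
  let ?c = "\<lambda>t::real. x + t *\<^sub>R v"
  let ?S = "?c -` T"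
  have S: "open ?S" by (intro open_vimage T) (auto intro!: continuous_intros)
  have S0: "0 \<in> ?S" using T assms by auto
  have sub: "?c ` ?S \<subseteq> W"
    using T assms by (auto intro!: subspace_add subspace_mul)
  have "((\<lambda>t. f (?c t)) has_derivative (\<lambda>t. D (t *\<^sub>R v))) (at 0)"
    if D: "(f has_derivative D) (at x within W)" for D
  proof -
    have "((\<lambda>t. f (?c t)) has_derivative (\<lambda>t. D (t *\<^sub>R v))) (at 0 within ?S)"
    proof (rule has_derivative_in_compose[where f = ?c and g = f])
      show "(?c has_derivative (\<lambda>t. t *\<^sub>R v)) (at 0 within ?S)"
        by (auto intro!: derivative_eq_intros)
      show "(f has_derivative D) (at (?c 0) within ?c ` ?S)"
        using has_derivative_subset[OF D sub] by simp
    qed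
    then show ?thesis using at_within_open[OF S0 S] by simp
  qed
  from has_derivative_unique[OF this[OF assms(1)] this[OF assms(2)]]
  have "(\<lambda>t. D1 (t *\<^sub>R v)) = (\<lambda>t. D2 (t *\<^sub>R v))" .
  from fun_cong[OF this, of 1] show ?thesis by simp
qed

text \<open>
  Local derivatives along \<open>v \<in> V\<close> agree with the chosen global one because such directional
  derivatives are unique on relatively open sets; hence regularity passes up the induction.
\<close>

lemma Ck_on_local:
  fixes f :: "'e::euclidean_space \<Rightarrow> 'b::real_normed_vector"
  assumes W: "openin (top_of_set V) W" and V: "subspace V"
    and loc: "\<And>x. x \<in> W \<Longrightarrow> \<exists>T. open T \<and> x \<in> T \<and> Ck_on k V (W \<inter> T) f"
  shows "Ck_on k V W f"
  using loc
proof (induction k arbitrary: f)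
  case 0
  have "continuous (at x within W) f" if x: "x \<in> W" for x
  proof -
    obtain T where "open T" "x \<in> T" "continuous_on (W \<inter> T) f" using 0[OF x] by auto
    then have "continuous (at x within (W \<inter> T)) f"
      using x by (simp add: continuous_on_eq_continuous_within)
    moreover have "at x within (W \<inter> T) = at x within W"
      using \<open>open T\<close> \<open>x \<in> T\<close> by (intro at_within_nhd[of _ T]) auto
    ultimately show ?thesis by simp
  qed
  then show ?case by (simp add: continuous_on_eq_continuous_within)
next
  case (Suc k)
  have "\<exists>D. (f has_derivative D) (at x within W)" if x: "x \<in> W" for x
  proof -
    obtain T where T: "open T" "x \<in> T" "Ck_on (Suc k) V (W \<inter> T) f" using Suc.prems[OF x] by auto
    then obtain D where "(f has_derivative D) (at x within (W \<inter> T))" using x by (auto simp: Ck_on.simps)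
    moreover have "at x within (W \<inter> T) = at x within W"
      using T by (intro at_within_nhd[of _ T]) auto
    ultimately show ?thesis by auto
  qed
  then obtain f' where f': "\<And>x. x \<in> W \<Longrightarrow> (f has_derivative f' x) (at x within W)" by metis
  show ?case
  proof (rule Ck_on_SucI[OF f'])
    fix v assume v: "v \<in> V"
    show "Ck_on k V W (\<lambda>x. f' x v)"
    proof (rule Suc.IH)
      fix x assume x: "x \<in> W"
      obtain T where T: "open T" "x \<in> T" "Ck_on (Suc k) V (W \<inter> T) f" using Suc.prems[OF x] by auto
      obtain g' where g': "\<And>x. x \<in> W \<inter> T \<Longrightarrow> (f has_derivative g' x) (at x within (W \<inter> T))"
        "\<And>v. v \<in> V \<Longrightarrow> Ck_on k V (W \<inter> T) (\<lambda>x. g' x v)"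
        using T(3) Ck_on_SucE by blast
      have op: "openin (top_of_set V) (W \<inter> T)" using W T(1) by (simp add: openin_Int_open)
      have "f' y v = g' y v" if y: "y \<in> W \<inter> T" for y
        using has_derivative_within_unique[OF has_derivative_subset[OF f'] g'(1)[OF y] op V y v] y
        by auto
      then have "Ck_on k V (W \<inter> T) (\<lambda>x. f' x v)" using Ck_on_cong[OF g'(2)[OF v]] by auto
      then show "\<exists>T. open T \<and> x \<in> T \<and> Ck_on k V (W \<inter> T) (\<lambda>x. f' x v)" using T by auto
    qed
  qed
qed

lemma smooth_onI: "(\<And>k. Ck_on k V W f) \<Longrightarrow> smooth_on V W f"
  by (simp add: smooth_on_def)

lemma smooth_onD: "smooth_on V W f \<Longrightarrow> Ck_on k V W f"
  by (simp add: smooth_on_def)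

lemma smooth_on_has_derivative:
  assumes "smooth_on V W f" "x \<in> W"
  shows "(f has_derivative frechet_derivative f (at x within W)) (at x within W)"
proof -
  have "Ck_on (Suc 0) V W f" using assms smooth_onD by blast
  then have "f differentiable (at x within W)" using assms(2) unfolding differentiable_def
    by (auto simp: Ck_on.simps)
  then show ?thesis by (simp add: frechet_derivative_works)
qed

text \<open>
  The definition of \<open>C\<^sup>k\<close> allows a different derivative for every \<open>k\<close>. Uniqueness along \<open>V\<close> makes all
  of them agree with one canonical choice.
\<close>

lemma smooth_on_directional_derivative:
  fixes f :: "'e::euclidean_space \<Rightarrow> 'b::real_normed_vector"
  assumes f: "smooth_on V W f" and W: "openin (top_of_set V) W" and V: "subspace V" and v: "v \<in> V"
  shows "smooth_on V W (\<lambda>x. frechet_derivative f (at x within W) v)"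
proof (rule smooth_onI)
  fix k
  obtain f' where f': "\<And>x. x \<in> W \<Longrightarrow> (f has_derivative f' x) (at x within W)"
    "\<And>v. v \<in> V \<Longrightarrow> Ck_on k V W (\<lambda>x. f' x v)"
    using smooth_onD[OF f, of "Suc k"] Ck_on_SucE by blast
  show "Ck_on k V W (\<lambda>x. frechet_derivative f (at x within W) v)"
    using Ck_on_cong[OF f'(2)[OF v]]
      has_derivative_within_unique[OF smooth_on_has_derivative[OF f] f'(1) W V _ v] by auto
qed

lemma Ck_on_diff_const: "Ck_on k V W (\<lambda>x. x - a)"
  using Ck_on_add[OF Ck_on_bounded_linear[OF bounded_linear_ident] Ck_on_const[of _ _ _ "- a"]] by simp

lemma smooth_on_subset: "smooth_on V W f \<Longrightarrow> S \<subseteq> W \<Longrightarrow> smooth_on V S f"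
  by (metis Ck_on_subset smooth_on_def)

section \<open>A smooth bump function\<close>

text \<open>
  The classical flat function \<open>exp (- 1 / x)\<close> for \<open>x > 0\<close>, multiplied by a polynomial in \<open>1 / x\<close>.
  The polynomial factor makes the family closed under differentiation, so that smoothness follows
  by induction.
\<close>

definition flat_poly :: "real poly \<Rightarrow> real \<Rightarrow> real" where
  "flat_poly p x = (if x > 0 then poly p (1 / x) * exp (- (1 / x)) else 0)"

lemma flat_poly_tendsto_0: "(flat_poly p \<longlongrightarrow> 0) (at_right 0)"
proof -
  have "((\<lambda>y. \<Sum>i\<le>degree p. coeff p i * (y ^ i / exp y)) \<longlongrightarrow> (\<Sum>i\<le>degree p. coeff p i * 0)) at_top"
    by (intro tendsto_intros tendsto_power_div_exp_0)
  then have "((\<lambda>y. poly p y * exp (- y)) \<longlongrightarrow> 0) at_top"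
    by (simp add: poly_altdef sum_distrib_right exp_minus field_simps sum_divide_distrib)
  then have "((\<lambda>x. poly p (inverse x) * exp (- inverse x)) \<longlongrightarrow> 0) (at_right 0)"
    by (rule filterlim_compose[OF _ filterlim_inverse_at_top_right])
  then show ?thesis
    by (rule Lim_transform_eventually)
      (auto simp: flat_poly_def eventually_at_filter inverse_eq_divide)
qed

text \<open>
  For \<open>x > 0\<close> the chain rule with \<open>(1 / x)' = - (1 / x)\<^sup>2\<close> produces the new polynomial factor
  \<open>y\<^sup>2 (p y - p' y)\<close>. At \<open>0\<close> the difference quotient from the right is the member of the family with
  factor \<open>y p y\<close>, which tends to \<open>0\<close>.
\<close>

lemma flat_poly_has_derivative:
  "(flat_poly p has_real_derivative flat_poly ([:0, 0, 1:] * (p - pderiv p)) x) (at x)"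
proof -
  consider "x > 0" | "x < 0" | "x = 0" by linarith
  then show ?thesis
  proof cases
    case 1
    have "((\<lambda>x. poly p (1 / x) * exp (- (1 / x))) has_real_derivative
        flat_poly ([:0, 0, 1:] * (p - pderiv p)) x) (at x)"
      using 1 by (auto intro!: derivative_eq_intros DERIV_chain2[OF poly_DERIV]
          simp: flat_poly_def field_simps power2_eq_square)
    then show ?thesis
      by (rule has_field_derivative_transform_within_open[where S = "{0<..}"])
        (use 1 in \<open>auto simp: flat_poly_def\<close>)
  next
    case 2
    have "((\<lambda>_. 0) has_real_derivative flat_poly ([:0, 0, 1:] * (p - pderiv p)) x) (at x)"
      using 2 by (auto simp: flat_poly_def)
    then show ?thesis
      by (rule has_field_derivative_transform_within_open[where S = "{..<0}"])
        (use 2 in \<open>auto simp: flat_poly_def\<close>)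
  next
    case 3
    have "((\<lambda>h. (flat_poly p (0 + h) - flat_poly p 0) / h) \<longlongrightarrow> 0) (at_right 0)"
      by (rule Lim_transform_eventually[OF flat_poly_tendsto_0[of "[:0, 1:] * p"]])
        (auto simp: flat_poly_def eventually_at_filter)
    moreover have "((\<lambda>h. (flat_poly p (0 + h) - flat_poly p 0) / h) \<longlongrightarrow> 0) (at_left 0)"
      by (rule Lim_transform_eventually[OF tendsto_const])
        (auto simp: flat_poly_def eventually_at_filter)
    ultimately have "((\<lambda>h. (flat_poly p (0 + h) - flat_poly p 0) / h) \<longlongrightarrow> 0) (at 0)"
      by (rule filterlim_split_at[rotated])
    then show ?thesis using 3 by (simp add: DERIV_def flat_poly_def)
  qed
qed

lemma Ck_on_flat_poly: "Ck_on k UNIV UNIV (flat_poly p)"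
proof (induction k arbitrary: p)
  case 0
  then show ?case
    by (auto intro!: DERIV_continuous_on flat_poly_has_derivative[THEN has_field_derivative_at_within])
next
  case (Suc k)
  show ?case
    by (rule Ck_on_SucI[where f' = "\<lambda>x v. flat_poly ([:0, 0, 1:] * (p - pderiv p)) x * v"])
      (use flat_poly_has_derivative[of p] Suc in
        \<open>auto simp: has_field_derivative_def intro!: Ck_on_bilinear[OF bounded_bilinear_mult] Ck_on_const\<close>)
qed

definition bump :: "'e::euclidean_space \<Rightarrow> real \<Rightarrow> 'e \<Rightarrow> real" where
  "bump a r x = flat_poly 1 (r\<^sup>2 - (x - a) \<bullet> (x - a))"

lemma bump_center: "r > 0 \<Longrightarrow> bump a r a > 0"
  by (simp add: bump_def flat_poly_def)

lemma bump_outside: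
  assumes "x \<notin> cball a r" "r > 0"
  shows "bump a r x = 0"
proof -
  have "norm (x - a) \<ge> r" using assms by (auto simp: dist_norm norm_minus_commute)
  then have "(x - a) \<bullet> (x - a) \<ge> r\<^sup>2"
    using assms(2) by (simp add: dot_square_norm)
  then show ?thesis by (simp add: bump_def flat_poly_def)
qed

lemma Ck_on_bump: "Ck_on k V W (bump a r)"
proof -
  have "Ck_on k V W (\<lambda>x. (- 1) * ((x - a) \<bullet> (x - a)) + r\<^sup>2)"
    by (intro Ck_on_add Ck_on_const Ck_on_bilinear[OF bounded_bilinear_inner] Ck_on_diff_const
        Ck_on_bilinear[OF bounded_bilinear_mult])
  then have "Ck_on k V W (\<lambda>x. r\<^sup>2 - (x - a) \<bullet> (x - a))"
    by (rule Ck_on_cong) simp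
  then have "Ck_on k V W (\<lambda>x. flat_poly 1 (r\<^sup>2 - (x - a) \<bullet> (x - a)))"
    by (rule Ck_on_compose[OF _ Ck_on_flat_poly]) auto
  then show ?thesis by (rule Ck_on_cong) (simp add: bump_def)
qed

section \<open>Hadamard's lemma\<close>

text \<open>
  Differentiation under the integral sign replaces the weight \<open>c t\<close> by \<open>c t * t\<close> and \<open>f\<close> by a
  directional derivative of \<open>f\<close>. The statement is about arbitrary continuous weights for the sake
  of this induction.
\<close>

lemma Ck_on_segment_average:
  fixes f :: "'e::euclidean_space \<Rightarrow> real"
  assumes V: "subspace V" and W: "convex W" "W \<subseteq> V" "a \<in> W"
    and "continuous_on {0..1} c" "Ck_on k V W f"
  shows "Ck_on k V W (\<lambda>x. integral {0..1} (\<lambda>t. c t * f (a + t *\<^sub>R (x - a))))"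
  using assms(5,6)
proof (induction k arbitrary: f c)
  case 0
  have f: "continuous_on W f" using 0(2) by simp
  have seg: "a + t *\<^sub>R (x - a) \<in> W" if "x \<in> W" "t \<in> {0..1}" for x t
  proof -
    have "a + t *\<^sub>R (x - a) = (1 - t) *\<^sub>R a + t *\<^sub>R x" by (simp add: algebra_simps)
    then show ?thesis using W that convexD[of W a x "1 - t" t] by simp
  qed
  have "continuous_on (W \<times> cbox 0 1) (\<lambda>(x, t). c t * f (a + t *\<^sub>R (x - a)))"
    using seg unfolding split_beta
    by (intro continuous_intros continuous_on_compose2[OF 0(1)] continuous_on_compose2[OF f]) auto
  from integral_continuous_on_param[OF this] show ?case by simp
next
  case (Suc k)
  have seg: "a + t *\<^sub>R (x - a) \<in> W" if "x \<in> W" "t \<in> {0..1}" for x t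
  proof -
    have "a + t *\<^sub>R (x - a) = (1 - t) *\<^sub>R a + t *\<^sub>R x" by (simp add: algebra_simps)
    then show ?thesis using W that convexD[of W a x "1 - t" t] by simp
  qed
  obtain f' where f': "\<And>x. x \<in> W \<Longrightarrow> (f has_derivative f' x) (at x within W)"
    "\<And>v. v \<in> V \<Longrightarrow> Ck_on k V W (\<lambda>x. f' x v)"
    using Suc.prems(2) Ck_on_SucE by blast
  obtain B where B: "B \<subseteq> V" "pairwise orthogonal B" "\<And>b. b \<in> B \<Longrightarrow> norm b = 1"
    "independent B" "span B = V"
    using orthonormal_basis_subspace[OF V] by metis
  have fin: "finite B" using B(4) independent_imp_finite by blast
  have cont_f: "continuous_on W f" and cont_f': "continuous_on W (\<lambda>x. f' x b)" if "b \<in> V" for b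
  proof -
    have "Ck_on 0 V W g" if "Ck_on j V W g" for j and g :: "'e \<Rightarrow> real"
      using that by (induction j) (auto dest: Ck_on_Suc_imp)
    from this[OF Suc.prems(2)] this[OF f'(2)[OF that]]
    show "continuous_on W f" "continuous_on W (\<lambda>x. f' x b)" by auto
  qed
  define D where "D x t = (\<Sum>b\<in>B. (c t * t * f' (a + t *\<^sub>R (x - a)) b) *\<^sub>R blinfun_inner_left b)" for x t
  have D: "blinfun_apply (D x t) v = c t * (\<Sum>b\<in>B. ((t *\<^sub>R v) \<bullet> b) *\<^sub>R f' (a + t *\<^sub>R (x - a)) b)" for x t v
    unfolding D_def blinfun.sum_left blinfun.scaleR_left sum_distrib_left
    by (intro sum.cong) (auto simp: algebra_simps)
  have contD: "continuous_on (W \<times> cbox 0 1) (\<lambda>(x, t). D x t)"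
    unfolding D_def split_beta using seg B(1)
    by (intro continuous_intros continuous_on_compose2[OF Suc.prems(1)]
        continuous_on_compose2[OF cont_f']) auto
  have contf: "continuous_on (W \<times> cbox 0 1) (\<lambda>(x, t). c t * f (a + t *\<^sub>R (x - a)))"
    using seg unfolding split_beta
    by (intro continuous_intros continuous_on_compose2[OF Suc.prems(1)]
        continuous_on_compose2[OF cont_f[OF subspace_0[OF V]]]) auto
  show ?case
  proof (rule Ck_on_SucI[where f' = "\<lambda>x. blinfun_apply (integral {0..1} (D x))"])
    fix x assume x: "x \<in> W"
    have "((\<lambda>x. integral (cbox 0 1) (\<lambda>t. c t * f (a + t *\<^sub>R (x - a)))) has_derivative
        integral (cbox 0 1) (D x)) (at x within W)"
    proof (rule leibniz_rule[OF _ _ contD x \<open>convex W\<close>])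
      fix x and t :: real assume x: "x \<in> W" and t: "t \<in> cbox 0 1"
      let ?y = "a + t *\<^sub>R (x - a)"
      have y: "?y \<in> W" using seg x t by simp
      have "(f has_derivative (\<lambda>v. \<Sum>b\<in>B. (v \<bullet> b) *\<^sub>R f' ?y b)) (at ?y within W)"
        using has_derivative_project[OF f'(1)[OF y] y W(2) V B(2,3) fin B(5)] .
      then have "(f has_derivative (\<lambda>v. \<Sum>b\<in>B. (v \<bullet> b) *\<^sub>R f' ?y b))
          (at ?y within (\<lambda>x. a + t *\<^sub>R (x - a)) ` W)"
        by (rule has_derivative_subset) (use seg t in auto)
      moreover have "((\<lambda>x. a + t *\<^sub>R (x - a)) has_derivative (\<lambda>v. t *\<^sub>R v)) (at x within W)"
        by (auto intro!: derivative_eq_intros)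
      ultimately have "((\<lambda>x. f (a + t *\<^sub>R (x - a))) has_derivative
          (\<lambda>v. \<Sum>b\<in>B. ((t *\<^sub>R v) \<bullet> b) *\<^sub>R f' ?y b)) (at x within W)"
        by (rule has_derivative_in_compose[rotated])
      then show "((\<lambda>x. c t * f (a + t *\<^sub>R (x - a))) has_derivative D x t) (at x within W)"
        unfolding D by (rule has_derivative_mult_right)
    next
      fix x assume "x \<in> W"
      then have "continuous_on (cbox 0 1) (\<lambda>t. c t * f (a + t *\<^sub>R (x - a)))"
        using continuous_on_compose2[OF contf, of "cbox 0 1" "Pair x"]
        by (auto simp: continuous_on_Pair)
      then show "(\<lambda>t. c t * f (a + t *\<^sub>R (x - a))) integrable_on cbox 0 1"
        by (rule integrable_continuous)
    qed
    then show "((\<lambda>x. integral {0..1} (\<lambda>t. c t * f (a + t *\<^sub>R (x - a)))) has_derivative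
        integral {0..1} (D x)) (at x within W)" by simp
  next
    fix v assume v: "v \<in> V"
    define g where "g x = (\<Sum>b\<in>B. (v \<bullet> b) *\<^sub>R f' x b)" for x
    have "Ck_on k V W g"
      unfolding g_def using B(1) f'(2)
      by (intro Ck_on_sum Ck_on_bilinear[OF bounded_bilinear_scaleR] Ck_on_const) auto
    then have "Ck_on k V W (\<lambda>x. integral {0..1} (\<lambda>t. (c t * t) * g (a + t *\<^sub>R (x - a))))"
      using Suc.prems(1) by (intro Suc.IH continuous_intros)
    then show "Ck_on k V W (\<lambda>x. integral {0..1} (D x) v)"
    proof (rule Ck_on_cong)
      fix x :: 'e assume x: "x \<in> W"
      have "continuous_on (cbox 0 1) (D x)"
        using continuous_on_compose2[OF contD, of "cbox 0 1" "Pair x"] x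
        by (auto simp: continuous_on_Pair)
      then have "D x integrable_on {0..1}" using integrable_continuous by fastforce
      then have "integral {0..1} (D x) v = integral {0..1} (\<lambda>t. D x t v)"
        by (rule blinfun_apply_integral)
      also have "\<dots> = integral {0..1} (\<lambda>t. (c t * t) * g (a + t *\<^sub>R (x - a)))"
        by (simp add: D g_def sum_distrib_left mult_ac)
      finally show "integral {0..1} (D x) v = \<dots>" .
    qed
  qed
qed

text \<open>
  Integrating the derivative of \<open>f\<close> along the segment from \<open>a\<close> to \<open>x\<close> recovers \<open>f x - f a\<close>; the
  coefficient of \<open>(x - a) \<bullet> b\<close> is the average of the derivative along \<open>b\<close> over that segment.
\<close>

lemma Hadamard_lemma:
  fixes f :: "'e::euclidean_space \<Rightarrow> real"
  assumes V: "subspace V" and W: "openin (top_of_set V) W" "convex W" "a \<in> W"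
    and f: "smooth_on V W f"
    and B: "B \<subseteq> V" "pairwise orthogonal B" "\<And>b. b \<in> B \<Longrightarrow> norm b = 1" "independent B" "span B = V"
  shows "\<exists>g. (\<forall>b\<in>B. smooth_on V W (g b) \<and> g b a = frechet_derivative f (at a within W) b) \<and>
    (\<forall>x\<in>W. f x = f a + (\<Sum>b\<in>B. ((x - a) \<bullet> b) * g b x))"
proof -
  have fin: "finite B" using B(4) independent_imp_finite by blast
  have WV: "W \<subseteq> V" using W(1) openin_imp_subset by blast
  define d where "d b x = frechet_derivative f (at x within W) b" for b x
  define g where "g b x = integral {0..1} (\<lambda>t. 1 * d b (a + t *\<^sub>R (x - a)))" for b x
  have d: "smooth_on V W (d b)" if "b \<in> B" for b
    unfolding d_def using smooth_on_directional_derivative[OF f W(1) V] that B(1) by auto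
  have "smooth_on V W (g b)" if "b \<in> B" for b
    unfolding g_def
    by (rule smooth_onI) (intro Ck_on_segment_average V W WV smooth_onD[OF d] that continuous_on_const)
  moreover have "g b a = frechet_derivative f (at a within W) b" if "b \<in> B" for b
    by (simp add: g_def d_def)
  moreover have "f x = f a + (\<Sum>b\<in>B. ((x - a) \<bullet> b) * g b x)" if x: "x \<in> W" for x
  proof -
    let ?c = "\<lambda>t::real. a + t *\<^sub>R (x - a)"
    have seg: "?c t \<in> W" if "t \<in> {0..1}" for t
    proof -
      have "?c t = (1 - t) *\<^sub>R a + t *\<^sub>R x" by (simp add: algebra_simps)
      then show ?thesis using W x that convexD[of W a x "1 - t" t] by simp
    qed
    have "((\<lambda>t. \<Sum>b\<in>B. ((x - a) \<bullet> b) * d b (?c t)) has_integral f (?c 1) - f (?c 0)) {0..1}"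
    proof (rule fundamental_theorem_of_calculus)
      fix t :: real assume t: "t \<in> {0..1}"
      have "(f has_derivative (\<lambda>v. \<Sum>b\<in>B. (v \<bullet> b) *\<^sub>R d b (?c t))) (at (?c t) within W)"
        unfolding d_def
        using has_derivative_project[OF smooth_on_has_derivative[OF f seg[OF t]] seg[OF t] WV V B(2,3) fin B(5)] .
      then have "(f has_derivative (\<lambda>v. \<Sum>b\<in>B. (v \<bullet> b) *\<^sub>R d b (?c t))) (at (?c t) within ?c ` {0..1})"
        by (rule has_derivative_subset) (use seg in auto)
      moreover have "(?c has_derivative (\<lambda>s. s *\<^sub>R (x - a))) (at t within {0..1})"
        by (auto intro!: derivative_eq_intros)
      ultimately have "((\<lambda>t. f (?c t)) has_derivative
          (\<lambda>s. \<Sum>b\<in>B. ((s *\<^sub>R (x - a)) \<bullet> b) *\<^sub>R d b (?c t))) (at t within {0..1})"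
        by (rule has_derivative_in_compose[rotated])
      then show "((\<lambda>t. f (?c t)) has_vector_derivative (\<Sum>b\<in>B. ((x - a) \<bullet> b) * d b (?c t)))
          (at t within {0..1})"
        unfolding has_vector_derivative_def by (simp add: sum_distrib_left mult.assoc)
    qed simp
    then have "f x - f a = integral {0..1} (\<lambda>t. \<Sum>b\<in>B. ((x - a) \<bullet> b) * d b (?c t))"
      by (simp add: integral_unique)
    also have "\<dots> = (\<Sum>b\<in>B. integral {0..1} (\<lambda>t. ((x - a) \<bullet> b) * d b (?c t)))"
    proof (rule integral_sum[OF fin])
      fix b assume b: "b \<in> B"
      have "continuous_on W (d b)" using smooth_onD[OF d[OF b], of 0] by simp
      then show "(\<lambda>t. ((x - a) \<bullet> b) * d b (?c t)) integrable_on {0..1}"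
        using seg by (intro integrable_continuous_interval continuous_intros
            continuous_on_compose2[OF \<open>continuous_on W (d b)\<close>]) auto
    qed
    also have "\<dots> = (\<Sum>b\<in>B. ((x - a) \<bullet> b) * g b x)"
      by (simp add: g_def)
    finally show ?thesis by simp
  qed
  ultimately show ?thesis by (intro exI[of _ g]) blast
qed

section \<open>Smooth functions and derivations on a manifold\<close>

context smooth_manifold
begin

lemma inv_chart:
  assumes "(U, \<phi>) \<in> A" "q \<in> U"
  shows "inv_into U \<phi> (\<phi> q) = q"
  by (rule homeomorphism_apply1[OF chart_homeomorphism[OF assms(1)] assms(2)])

lemma chart_image_subset: "(U, \<phi>) \<in> A \<Longrightarrow> \<phi> ` U \<subseteq> V"
  by (rule openin_imp_subset[OF chart_image_open])

lemma chart_in_model: "(U, \<phi>) \<in> A \<Longrightarrow> q \<in> U \<Longrightarrow> \<phi> q \<in> V"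
  using chart_image_subset by blast

lemma continuous_on_chart: "(U, \<phi>) \<in> A \<Longrightarrow> continuous_on U \<phi>"
  by (rule homeomorphism_cont1[OF chart_homeomorphism])

lemma continuous_on_inv_chart: "(U, \<phi>) \<in> A \<Longrightarrow> continuous_on (\<phi> ` U) (inv_into U \<phi>)"
  by (rule homeomorphism_cont2[OF chart_homeomorphism])

lemma openin_chart_image:
  assumes "(U, \<phi>) \<in> A" "open T"
  shows "openin (top_of_set V) (\<phi> ` (U \<inter> T))"
  by (rule openin_trans[OF homeomorphism_imp_open_map[OF chart_homeomorphism[OF assms(1)]]
        chart_image_open[OF assms(1)]]) (simp add: assms(2) openin_open_Int)

lemma chart_at:
  obtains U \<phi> where "(U, \<phi>) \<in> A" "p \<in> U"
proof -
  have "p \<in> (\<Union>(U, \<phi>)\<in>A. U)" by (simp add: charts_cover)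
  then show thesis using that by auto
qed

lemma smooth_functionsD:
  "f \<in> smooth_functions V A \<Longrightarrow> (U, \<phi>) \<in> A \<Longrightarrow> smooth_on V (\<phi> ` U) (f \<circ> inv_into U \<phi>)"
  by (auto simp: smooth_functions_def)

text \<open>
  Compatibility of the charts makes it sufficient to test smoothness near each point in a single
  chart of one's choice.
\<close>

lemma smooth_functionsI_local:
  assumes loc: "\<And>p. \<exists>U \<phi> T. (U, \<phi>) \<in> A \<and> p \<in> U \<and> open T \<and> p \<in> T \<and>
    smooth_on V (\<phi> ` (U \<inter> T)) (f \<circ> inv_into U \<phi>)"
  shows "f \<in> smooth_functions V A"
proof -
  have "Ck_on k V (\<psi> ` U') (f \<circ> inv_into U' \<psi>)" if chart': "(U', \<psi>) \<in> A" for U' \<psi> k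
  proof (rule Ck_on_local[OF chart_image_open[OF chart'] subspace_model])
    fix x assume "x \<in> \<psi> ` U'"
    then obtain q where q: "q \<in> U'" "x = \<psi> q" by auto
    obtain U \<phi> T where chart: "(U, \<phi>) \<in> A" and T: "q \<in> U" "open T" "q \<in> T"
      and smooth: "smooth_on V (\<phi> ` (U \<inter> T)) (f \<circ> inv_into U \<phi>)"
      using loc by blast
    have "openin (top_of_set V) (\<psi> ` (U' \<inter> (U \<inter> T)))"
      by (rule openin_chart_image[OF chart' open_Int[OF chart_open[OF chart] T(2)]])
    then obtain Q where Q: "open Q" "\<psi> ` (U' \<inter> (U \<inter> T)) = V \<inter> Q" by (auto simp: openin_open)
    have eq: "\<psi> ` U' \<inter> Q = \<psi> ` (U' \<inter> (U \<inter> T))"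
      using Q(2) chart_image_subset[OF chart'] by blast
    have "Ck_on k V (\<psi> ` (U' \<inter> (U \<inter> T))) (\<phi> \<circ> inv_into U' \<psi>)"
      by (rule Ck_on_subset[OF smooth_onD[OF charts_compatible[OF chart' chart]]]) auto
    then have "Ck_on k V (\<psi> ` (U' \<inter> (U \<inter> T)))
        (\<lambda>x. (f \<circ> inv_into U \<phi>) ((\<phi> \<circ> inv_into U' \<psi>) x))"
      by (rule Ck_on_compose[OF _ smooth_onD[OF smooth]])
        (use chart_image_subset[OF chart] in \<open>auto simp: inv_chart[OF chart'] subspace_model\<close>)
    then have "Ck_on k V (\<psi> ` U' \<inter> Q) (f \<circ> inv_into U' \<psi>)"
      unfolding eq
      by (rule Ck_on_cong) (auto simp: inv_chart[OF chart'] inv_chart[OF chart])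
    moreover have "x \<in> Q" using Q(2) q T by auto
    ultimately show "\<exists>Q. open Q \<and> x \<in> Q \<and> Ck_on k V (\<psi> ` U' \<inter> Q) (f \<circ> inv_into U' \<psi>)"
      using Q(1) by blast
  qed
  then show ?thesis by (auto simp: smooth_functions_def smooth_on_def)
qed

lemma smooth_functions_const: "(\<lambda>_. c) \<in> smooth_functions V A"
  by (auto simp: smooth_functions_def smooth_on_def o_def intro!: Ck_on_const)

lemma smooth_functions_add:
  "f \<in> smooth_functions V A \<Longrightarrow> g \<in> smooth_functions V A \<Longrightarrow> (\<lambda>q. f q + g q) \<in> smooth_functions V A"
  by (auto simp: smooth_functions_def smooth_on_def o_def intro!: Ck_on_add)

lemma smooth_functions_mult:
  "f \<in> smooth_functions V A \<Longrightarrow> g \<in> smooth_functions V A \<Longrightarrow> (\<lambda>q. f q * g q) \<in> smooth_functions V A"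
  by (auto simp: smooth_functions_def smooth_on_def o_def
      intro!: Ck_on_bilinear[OF bounded_bilinear_mult])

lemma smooth_functions_sum:
  "(\<And>i. i \<in> I \<Longrightarrow> f i \<in> smooth_functions V A) \<Longrightarrow> (\<lambda>q. \<Sum>i\<in>I. f i q) \<in> smooth_functions V A"
  by (induction I rule: infinite_finite_induct)
    (auto intro: smooth_functions_const smooth_functions_add)

text \<open>
  A function given near \<open>p\<close> in a chart becomes globally smooth after multiplication by a bump
  function. The support lies in the preimage \<open>K\<close> of a closed ball, which is compact, hence closed
  because the manifold is Hausdorff, so the product vanishes on the open complement of \<open>K\<close>.
\<close>

lemma smooth_functions_bump_mult:
  assumes chart: "(U, \<phi>) \<in> A" and p: "p \<in> U" and R: "ball (\<phi> p) R \<inter> V \<subseteq> \<phi> ` U"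
    and r: "0 < r" "r < R" and g: "smooth_on V (ball (\<phi> p) R \<inter> V) g"
  shows "(\<lambda>q. if q \<in> U then bump (\<phi> p) r (\<phi> q) * g (\<phi> q) else 0) \<in> smooth_functions V A"
proof -
  let ?f = "\<lambda>q. if q \<in> U then bump (\<phi> p) r (\<phi> q) * g (\<phi> q) else 0"
  define K where "K = inv_into U \<phi> ` (cball (\<phi> p) r \<inter> V)"
  have sub: "cball (\<phi> p) r \<inter> V \<subseteq> \<phi> ` U" using R r by auto
  have "compact (cball (\<phi> p) r \<inter> V)"
    by (intro compact_Int_closed closed_subspace subspace_model) auto
  then have "compact K" unfolding K_def
    by (intro compact_continuous_image continuous_on_subset[OF continuous_on_inv_chart[OF chart] sub])
  then have "closed K" by (rule compact_imp_closed)
  have K: "q \<in> K" if "q \<in> U" "\<phi> q \<in> cball (\<phi> p) r" for q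
    unfolding K_def using that chart_in_model[OF chart] inv_chart[OF chart] by (auto intro!: image_eqI[of _ _ "\<phi> q"])
  show ?thesis
  proof (rule smooth_functionsI_local)
    fix q
    show "\<exists>U' \<psi> T. (U', \<psi>) \<in> A \<and> q \<in> U' \<and> open T \<and> q \<in> T \<and>
      smooth_on V (\<psi> ` (U' \<inter> T)) (?f \<circ> inv_into U' \<psi>)"
    proof (cases "q \<in> K")
      case True
      define T where "T = U \<inter> \<phi> -` ball (\<phi> p) R"
      have "open T" unfolding T_def
        using continuous_open_preimage[OF continuous_on_chart[OF chart] chart_open[OF chart]] by auto
      obtain z where z: "z \<in> cball (\<phi> p) r" "z \<in> V" "q = inv_into U \<phi> z" using True K_def by auto
      then obtain q' where "q' \<in> U" "z = \<phi> q'" using sub by auto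
      then have q: "q \<in> U" "\<phi> q = z" using z(3) inv_chart[OF chart] by auto
      then have "q \<in> T" using z r by (auto simp: T_def)
      have "smooth_on V (\<phi> ` (U \<inter> T)) (?f \<circ> inv_into U \<phi>)"
      proof (rule smooth_onI)
        fix k
        have "Ck_on k V (ball (\<phi> p) R \<inter> V) (\<lambda>x. bump (\<phi> p) r x * g x)"
          by (intro Ck_on_bilinear[OF bounded_bilinear_mult] Ck_on_bump smooth_onD[OF g])
        then have "Ck_on k V (\<phi> ` (U \<inter> T)) (\<lambda>x. bump (\<phi> p) r x * g x)"
          by (rule Ck_on_subset) (use chart_in_model[OF chart] in \<open>auto simp: T_def\<close>)
        then show "Ck_on k V (\<phi> ` (U \<inter> T)) (?f \<circ> inv_into U \<phi>)"
          by (rule Ck_on_cong) (auto simp: inv_chart[OF chart])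
      qed
      then show ?thesis using chart \<open>q \<in> U\<close> \<open>open T\<close> \<open>q \<in> T\<close> by blast
    next
      case False
      obtain U' \<psi> where chart': "(U', \<psi>) \<in> A" "q \<in> U'" using chart_at by blast
      have zero: "bump (\<phi> p) r (\<phi> y) = 0" if "y \<in> U" "y \<notin> K" for y
        using K[of y] that bump_outside[of "\<phi> y" "\<phi> p" r] r by auto
      have "smooth_on V (\<psi> ` (U' \<inter> - K)) (?f \<circ> inv_into U' \<psi>)"
        by (rule smooth_onI, rule Ck_on_cong[OF Ck_on_const[of _ _ _ 0]])
          (auto simp: inv_chart[OF chart'(1)] zero)
      then show ?thesis using chart' \<open>closed K\<close> False by (blast intro: open_Compl)
    qed
  qed
qed

lemma tangent_add:
  "v \<in> tangent_space V A p \<Longrightarrow> f \<in> smooth_functions V A \<Longrightarrow> g \<in> smooth_functions V A \<Longrightarrow>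
    v (\<lambda>q. f q + g q) = v f + v g"
  by (simp add: tangent_space_def)

lemma tangent_scale:
  "v \<in> tangent_space V A p \<Longrightarrow> f \<in> smooth_functions V A \<Longrightarrow> v (\<lambda>q. c * f q) = c * v f"
  by (simp add: tangent_space_def)

lemma tangent_mult:
  "v \<in> tangent_space V A p \<Longrightarrow> f \<in> smooth_functions V A \<Longrightarrow> g \<in> smooth_functions V A \<Longrightarrow>
    v (\<lambda>q. f q * g q) = f p * v g + g p * v f"
  by (simp add: tangent_space_def)

lemma tangent_not_smooth: "v \<in> tangent_space V A p \<Longrightarrow> f \<notin> smooth_functions V A \<Longrightarrow> v f = 0"
  by (simp add: tangent_space_def)

text \<open>
  The Leibniz rule for \<open>1 = 1 * 1\<close> says \<open>v 1 = 2 * v 1\<close>.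
\<close>

lemma tangent_const:
  assumes "v \<in> tangent_space V A p"
  shows "v (\<lambda>_. c) = 0"
proof -
  have "v (\<lambda>_. 1) = 0"
    using tangent_mult[OF assms smooth_functions_const[of 1] smooth_functions_const[of 1]] by simp
  then show ?thesis using tangent_scale[OF assms smooth_functions_const[of 1], of c] by simp
qed

lemma tangent_sum:
  assumes v: "v \<in> tangent_space V A p" and f: "\<And>i. i \<in> I \<Longrightarrow> f i \<in> smooth_functions V A"
  shows "v (\<lambda>q. \<Sum>i\<in>I. f i q) = (\<Sum>i\<in>I. v (f i))"
  using f
proof (induction I rule: infinite_finite_induct)
  case (insert i I)
  then show ?case
    using tangent_add[OF v, of "f i" "\<lambda>q. \<Sum>i\<in>I. f i q"] smooth_functions_sum[of I f] by simp
qed (auto simp: tangent_const[OF v])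

lemma tangent_spaceI:
  assumes "\<And>f g. f \<in> smooth_functions V A \<Longrightarrow> g \<in> smooth_functions V A \<Longrightarrow>
      v (\<lambda>q. f q + g q) = v f + v g"
    and "\<And>f c. f \<in> smooth_functions V A \<Longrightarrow> v (\<lambda>q. c * f q) = c * v f"
    and "\<And>f g. f \<in> smooth_functions V A \<Longrightarrow> g \<in> smooth_functions V A \<Longrightarrow>
      v (\<lambda>q. f q * g q) = f p * v g + g p * v f"
    and "\<And>f. f \<notin> smooth_functions V A \<Longrightarrow> v f = 0"
  shows "v \<in> tangent_space V A p"
  using assms by (simp add: tangent_space_def)

lemma tangent_space_add:
  "u \<in> tangent_space V A p \<Longrightarrow> v \<in> tangent_space V A p \<Longrightarrow> (\<lambda>f. u f + v f) \<in> tangent_space V A p"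
  by (rule tangent_spaceI)
    (simp_all add: tangent_add tangent_scale tangent_mult tangent_not_smooth algebra_simps)

lemma tangent_space_scale:
  "u \<in> tangent_space V A p \<Longrightarrow> (\<lambda>f. c * u f) \<in> tangent_space V A p"
  by (rule tangent_spaceI)
    (simp_all add: tangent_add tangent_scale tangent_mult tangent_not_smooth algebra_simps)

lemma tangent_space_zero: "(\<lambda>_. 0) \<in> tangent_space V A p"
  by (rule tangent_spaceI) simp_all

lemma tangent_space_sum:
  "(\<And>i. i \<in> I \<Longrightarrow> u i \<in> tangent_space V A p) \<Longrightarrow> (\<lambda>f. \<Sum>i\<in>I. c i * u i f) \<in> tangent_space V A p"
  by (induction I rule: infinite_finite_induct)
    (auto intro: tangent_space_zero tangent_space_add[OF tangent_space_scale])

text \<open>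
  Every derivation at \<open>p\<close> is a directional derivative. With a bump function \<open>\<chi>\<close> supported near \<open>p\<close>,
  Hadamard's lemma yields \<open>\<chi>\<^sup>2 (f - f p) = (\<Sum>b. (\<chi> x\<^sub>b) * (\<chi> g\<^sub>b))\<close> with globally smooth factors, where
  \<open>x\<^sub>b\<close> are coordinates centred at \<open>p\<close> and \<open>g\<^sub>b p\<close> is the partial derivative of \<open>f\<close>. Applying the
  Leibniz rule to both sides and dividing by \<open>(\<chi> p)\<^sup>2 > 0\<close> expresses \<open>v f\<close> through the numbers
  \<open>v (\<chi> x\<^sub>b)\<close>.
\<close>

theorem tangent_vector_is_directional_derivative:
  assumes chart: "(U, \<phi>) \<in> A" and p: "p \<in> U" and v: "v \<in> tangent_space V A p"
  shows "\<exists>w\<in>V. \<forall>f\<in>smooth_functions V A.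
    v f = frechet_derivative (f \<circ> inv_into U \<phi>) (at (\<phi> p) within \<phi> ` U) w"
proof -
  let ?a = "\<phi> p"
  obtain B where B: "B \<subseteq> V" "pairwise orthogonal B" "\<And>b. b \<in> B \<Longrightarrow> norm b = 1"
    "independent B" "span B = V"
    using orthonormal_basis_subspace[OF subspace_model] by metis
  obtain T where T: "open T" "\<phi> ` U = V \<inter> T"
    using chart_image_open[OF chart] by (auto simp: openin_open)
  then obtain R where R: "R > 0" "ball ?a R \<subseteq> T" using p open_contains_ball by blast
  \<comment> \<open>a convex part of the chart image, as Hadamard's lemma integrates along segments\<close>
  define W where "W = ball ?a R \<inter> V"
  have WU: "W \<subseteq> \<phi> ` U" using R T by (auto simp: W_def)
  have W: "openin (top_of_set V) W" "convex W" "?a \<in> W"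
    using R p chart_in_model[OF chart]
    by (auto simp: W_def convex_Int subspace_imp_convex subspace_model openin_open_Int inf_commute)
  define r where "r = R / 2"
  have r: "0 < r" "r < R" using R by (auto simp: r_def)
  define ext where "ext g q = (if q \<in> U then bump ?a r (\<phi> q) * g (\<phi> q) else 0)" for g q
  have ext: "ext g \<in> smooth_functions V A" if "smooth_on V W g" for g
    unfolding ext_def
    by (rule smooth_functions_bump_mult[OF chart p _ r]) (use that WU W_def in auto)
  let ?\<chi> = "ext (\<lambda>_. 1)"
  define c where "c = ?\<chi> p"
  have c: "c > 0" using p r(1) by (simp add: c_def ext_def bump_center)
  have \<chi>: "?\<chi> \<in> smooth_functions V A" by (intro ext smooth_onI Ck_on_const)
  let ?x = "\<lambda>b. ext (\<lambda>x. (x - ?a) \<bullet> b)"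
  have x: "?x b \<in> smooth_functions V A" for b
    by (intro ext smooth_onI Ck_on_bilinear[OF bounded_bilinear_inner] Ck_on_diff_const Ck_on_const)
  define w where "w = (\<Sum>b\<in>B. (v (?x b) / c) *\<^sub>R b)"
  have wV: "w \<in> V" unfolding w_def using B(1) subspace_model
    by (intro subspace_sum subspace_mul) auto
  have "v f = frechet_derivative (f \<circ> inv_into U \<phi>) (at ?a within \<phi> ` U) w"
    if f: "f \<in> smooth_functions V A" for f
  proof -
    let ?F = "f \<circ> inv_into U \<phi>"
    have F: "smooth_on V (\<phi> ` U) ?F" using smooth_functionsD[OF f chart] .
    then have FW: "smooth_on V W ?F" by (rule smooth_on_subset[OF _ WU])
    have "\<exists>g. (\<forall>b\<in>B. smooth_on V W (g b) \<and> g b ?a = frechet_derivative ?F (at ?a within W) b) \<and>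
        (\<forall>x\<in>W. ?F x = ?F ?a + (\<Sum>b\<in>B. ((x - ?a) \<bullet> b) * g b x))"
      by (rule Hadamard_lemma[OF subspace_model W FW B])
    then obtain g where
      g1: "\<forall>b\<in>B. smooth_on V W (g b) \<and> g b ?a = frechet_derivative ?F (at ?a within W) b" and
      g2: "\<forall>x\<in>W. ?F x = ?F ?a + (\<Sum>b\<in>B. ((x - ?a) \<bullet> b) * g b x)"
      by (elim exE conjE)
    have g: "b \<in> B \<Longrightarrow> smooth_on V W (g b)"
      "b \<in> B \<Longrightarrow> g b ?a = frechet_derivative ?F (at ?a within W) b"
      "x \<in> W \<Longrightarrow> ?F x = ?F ?a + (\<Sum>b\<in>B. ((x - ?a) \<bullet> b) * g b x)" for b x
      using g1 g2 by blast+
    let ?d = "\<lambda>q. f q + - f p"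
    have d: "?d \<in> smooth_functions V A" by (rule smooth_functions_add[OF f smooth_functions_const])
    have \<chi>d: "(\<lambda>q. ?\<chi> q * ?d q) \<in> smooth_functions V A" by (rule smooth_functions_mult[OF \<chi> d])
    have "(\<lambda>q. ?\<chi> q * (?\<chi> q * ?d q)) = (\<lambda>q. \<Sum>b\<in>B. ?x b q * ext (g b) q)"
    proof
      fix q
      show "?\<chi> q * (?\<chi> q * ?d q) = (\<Sum>b\<in>B. ?x b q * ext (g b) q)"
      proof (cases "q \<in> U \<and> \<phi> q \<in> W")
        case True
        then have "?d q = (\<Sum>b\<in>B. ((\<phi> q - ?a) \<bullet> b) * g b (\<phi> q))"
          using g(3)[of "\<phi> q"] p by (simp add: inv_chart[OF chart])
        then show ?thesis using True
          by (simp add: ext_def sum_distrib_left mult_ac)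
      next
        case False
        then have "ext g' q = 0" for g'
          using r(2) bump_outside[of "\<phi> q" ?a r] r(1) chart_in_model[OF chart]
          by (auto simp: ext_def W_def)
        then show ?thesis by simp
      qed
    qed
    then have "v (\<lambda>q. ?\<chi> q * (?\<chi> q * ?d q)) = v (\<lambda>q. \<Sum>b\<in>B. ?x b q * ext (g b) q)" by simp
    also have "\<dots> = (\<Sum>b\<in>B. v (\<lambda>q. ?x b q * ext (g b) q))"
      by (intro tangent_sum[OF v] smooth_functions_mult x ext g)
    also have "\<dots> = (\<Sum>b\<in>B. c * g b ?a * v (?x b))"
    proof (rule sum.cong[OF refl])
      fix b assume "b \<in> B"
      then have "v (\<lambda>q. ?x b q * ext (g b) q) = ?x b p * v (ext (g b)) + ext (g b) p * v (?x b)"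
        by (intro tangent_mult[OF v] x ext g)
      then show "v (\<lambda>q. ?x b q * ext (g b) q) = c * g b ?a * v (?x b)"
        using p by (simp add: ext_def c_def)
    qed
    finally have "c * (c * v f) = (\<Sum>b\<in>B. c * g b ?a * v (?x b))"
      using tangent_mult[OF v \<chi> \<chi>d] tangent_mult[OF v \<chi> d]
        tangent_add[OF v f smooth_functions_const[of "- f p"]] tangent_const[OF v]
      by (simp add: c_def)
    then have "v f = (\<Sum>b\<in>B. c * g b ?a * v (?x b)) / (c * c)"
      using c by (simp add: field_simps)
    also have "\<dots> = (\<Sum>b\<in>B. (v (?x b) / c) * g b ?a)"
      unfolding sum_divide_distrib by (intro sum.cong) (use c in \<open>auto simp: field_simps\<close>)
    finally have vf: "v f = (\<Sum>b\<in>B. (v (?x b) / c) * g b ?a)" .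
    have lin: "linear (frechet_derivative ?F (at ?a within W))"
      by (rule has_derivative_linear[OF smooth_on_has_derivative[OF FW W(3)]])
    have "v f = frechet_derivative ?F (at ?a within W) w"
      unfolding vf w_def linear_sum[OF lin] by (intro sum.cong) (auto simp: linear_cmul[OF lin] g(2))
    also have "\<dots> = frechet_derivative ?F (at ?a within \<phi> ` U) w"
      using smooth_on_has_derivative[OF FW W(3)]
        has_derivative_subset[OF smooth_on_has_derivative[OF F] WU] p
      by (intro has_derivative_within_unique[OF _ _ W(1) subspace_model W(3) wV]) blast+
    finally show ?thesis .
  qed
  then show ?thesis using wV by (intro bexI[of _ w] ballI)
qed

section \<open>Orthonormal bases of tangent spaces\<close>

lemma metric_sym:
  assumes "riemannian_metric V A h" "u \<in> tangent_space V A p" "v \<in> tangent_space V A p"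
  shows "h p u v = h p v u"
  using assms unfolding riemannian_metric_def by blast

lemma metric_add:
  assumes "riemannian_metric V A h"
    "u \<in> tangent_space V A p" "v \<in> tangent_space V A p" "w \<in> tangent_space V A p"
  shows "h p (\<lambda>f. u f + v f) w = h p u w + h p v w"
proof -
  have "h p (u + v) w = h p u w + h p v w"
    using assms unfolding riemannian_metric_def by blast
  then show ?thesis by (simp add: plus_fun_def)
qed

lemma metric_scale:
  assumes "riemannian_metric V A h" "u \<in> tangent_space V A p" "v \<in> tangent_space V A p"
  shows "h p (\<lambda>f. c * u f) v = c * h p u v"
  using assms unfolding riemannian_metric_def by blast

lemma metric_pos:
  assumes "riemannian_metric V A h" "u \<in> tangent_space V A p" "u \<noteq> (\<lambda>_. 0)"
  shows "h p u u > 0"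
  using assms unfolding riemannian_metric_def zero_fun_def by blast

lemma metric_zero:
  assumes "riemannian_metric V A h" "w \<in> tangent_space V A p"
  shows "h p (\<lambda>_. 0) w = 0"
  using metric_scale[OF assms(1) tangent_space_zero assms(2), of 0] by simp

lemma metric_sum:
  assumes h: "riemannian_metric V A h" and w: "w \<in> tangent_space V A p"
    and u: "\<And>i. i \<in> I \<Longrightarrow> u i \<in> tangent_space V A p"
  shows "h p (\<lambda>f. \<Sum>i\<in>I. c i * u i f) w = (\<Sum>i\<in>I. c i * h p (u i) w)"
  using u
proof (induction I rule: infinite_finite_induct)
  case (insert i I)
  then show ?case
    using metric_add[OF h tangent_space_scale[of "u i" p "c i"] tangent_space_sum[of I u p c] w]
      metric_scale[OF h _ w, of "u i" "c i"] by simp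
qed (auto simp: metric_zero[OF h w])

definition orthonormal_tangent :: "'m metric_tensor \<Rightarrow> 'm \<Rightarrow> 'm tangent_vector set \<Rightarrow> bool" where
  "orthonormal_tangent h p S \<longleftrightarrow> finite S \<and> S \<subseteq> tangent_space V A p \<and>
    (\<forall>e\<in>S. \<forall>e'\<in>S. h p e e' = (if e = e' then 1 else 0))"

text \<open>
  Tangent vectors are directional derivatives along vectors of \<open>V\<close>, and a linear relation between
  these vectors is one between the tangent vectors. The vectors of \<open>V\<close> belonging to an orthonormal
  system are therefore independent.
\<close>

lemma card_orthonormal_tangent_le:
  assumes h: "riemannian_metric V A h" and S: "orthonormal_tangent h p S"
  shows "card S \<le> dim V"
proof -
  obtain U \<phi> where chart: "(U, \<phi>) \<in> A" and p: "p \<in> U" by (rule chart_at)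
  define D where "D f = frechet_derivative (f \<circ> inv_into U \<phi>) (at (\<phi> p) within \<phi> ` U)" for f :: "'m \<Rightarrow> real"
  have lin: "linear (D f)" if "f \<in> smooth_functions V A" for f
    unfolding D_def
    by (rule has_derivative_linear[OF smooth_on_has_derivative[OF smooth_functionsD[OF that chart]]])
      (use p in simp)
  have fin: "finite S" and ST: "\<And>e. e \<in> S \<Longrightarrow> e \<in> tangent_space V A p"
    and ortho: "\<And>e e'. e \<in> S \<Longrightarrow> e' \<in> S \<Longrightarrow> h p e e' = (if e = e' then 1 else 0)"
    using S by (auto simp: orthonormal_tangent_def)
  have "\<exists>w\<in>V. \<forall>f\<in>smooth_functions V A. u f = D f w" if "u \<in> tangent_space V A p" for u
    unfolding D_def by (rule tangent_vector_is_directional_derivative[OF chart p that])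
  then obtain w where w: "\<And>u. u \<in> tangent_space V A p \<Longrightarrow> w u \<in> V"
    "\<And>u f. u \<in> tangent_space V A p \<Longrightarrow> f \<in> smooth_functions V A \<Longrightarrow> u f = D f (w u)"
    by metis
  have inj: "inj_on w S"
  proof (rule inj_onI)
    fix e e' assume e: "e \<in> S" "e' \<in> S" "w e = w e'"
    have "e f = e' f" for f
      using w(2)[OF ST[OF e(1)], of f] w(2)[OF ST[OF e(2)], of f] e(3)
        tangent_not_smooth[OF ST[OF e(1)], of f] tangent_not_smooth[OF ST[OF e(2)], of f]
      by (cases "f \<in> smooth_functions V A") auto
    then show "e = e'" by auto
  qed
  have "independent (w ` S)"
  proof (rule independent_if_scalars_zero)
    fix c x assume "(\<Sum>x\<in>w ` S. c x *\<^sub>R x) = 0" and x: "x \<in> w ` S"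
    then have zero: "(\<Sum>e\<in>S. c (w e) *\<^sub>R w e) = 0" by (simp add: sum.reindex[OF inj] o_def)
    have "(\<Sum>e\<in>S. c (w e) * e f) = 0" for f
    proof (cases "f \<in> smooth_functions V A")
      case True
      have "(\<Sum>e\<in>S. c (w e) * e f) = D f (\<Sum>e\<in>S. c (w e) *\<^sub>R w e)"
        unfolding linear_sum[OF lin[OF True]]
        by (intro sum.cong refl) (simp add: w(2)[OF ST True] linear_cmul[OF lin[OF True]])
      then show ?thesis using linear_0[OF lin[OF True]] by (simp add: zero)
    next
      case False
      then show ?thesis by (simp add: tangent_not_smooth[OF ST])
    qed
    then have comb: "(\<lambda>f. \<Sum>e\<in>S. c (w e) * e f) = (\<lambda>_. 0)" by simp
    obtain e0 where e0: "e0 \<in> S" "x = w e0" using x by auto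
    have "0 = h p (\<lambda>f. \<Sum>e\<in>S. c (w e) * e f) e0"
      unfolding comb using metric_zero[OF h ST[OF e0(1)]] by simp
    also have "\<dots> = (\<Sum>e\<in>S. c (w e) * h p e e0)"
      by (rule metric_sum[OF h ST[OF e0(1)] ST])
    also have "\<dots> = (\<Sum>e\<in>S. if e = e0 then c (w e) else 0)"
      by (intro sum.cong refl) (simp add: ortho e0(1))
    also have "\<dots> = c (w e0)" using fin e0(1) by simp
    finally show "c x = 0" using e0(2) by simp
  qed (use fin in simp)
  moreover have "w ` S \<subseteq> V" using w(1) ST by auto
  ultimately have "card (w ` S) \<le> dim V" by (intro independent_card_le_dim)
  then show ?thesis by (simp add: card_image[OF inj])
qed

text \<open>
  An orthonormal system of maximal size spans: otherwise some \<open>u\<close> would differ from its projection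
  by a non-zero \<open>r\<close>, and the normalised \<open>r\<close> could be added to the system.
\<close>

lemma orthonormal_tangent_basis:
  assumes h: "riemannian_metric V A h"
  shows "\<exists>S. orthonormal_tangent h p S \<and>
    (\<forall>u\<in>tangent_space V A p. \<forall>f. u f = (\<Sum>e\<in>S. h p u e * e f))"
proof -
  have empty: "orthonormal_tangent h p {}" by (simp add: orthonormal_tangent_def)
  have bound: "\<forall>S. orthonormal_tangent h p S \<longrightarrow> card S < Suc (dim V)"
    using card_orthonormal_tangent_le[OF h] by (simp add: less_Suc_eq_le)
  obtain S where S: "orthonormal_tangent h p S"
    and max: "\<And>S'. orthonormal_tangent h p S' \<Longrightarrow> card S' \<le> card S"
    using ex_has_greatest_nat[where P = "orthonormal_tangent h p" and f = card, OF empty bound] by auto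
  have fin: "finite S" and ST: "\<And>e. e \<in> S \<Longrightarrow> e \<in> tangent_space V A p"
    and ortho: "\<And>e e'. e \<in> S \<Longrightarrow> e' \<in> S \<Longrightarrow> h p e e' = (if e = e' then 1 else 0)"
    using S by (auto simp: orthonormal_tangent_def)
  have "u f = (\<Sum>e\<in>S. h p u e * e f)" if u: "u \<in> tangent_space V A p" for u f
  proof -
    define s where "s = (\<lambda>f. \<Sum>e\<in>S. h p u e * e f)"
    define r where "r = (\<lambda>f. u f + - 1 * s f)"
    have s: "s \<in> tangent_space V A p" unfolding s_def by (rule tangent_space_sum[OF ST])
    have r: "r \<in> tangent_space V A p" unfolding r_def
      by (rule tangent_space_add[OF u tangent_space_scale[OF s]])
    have re: "h p r e = 0" if e: "e \<in> S" for e
    proof -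
      have "h p s e = (\<Sum>e'\<in>S. h p u e' * h p e' e)"
        unfolding s_def by (rule metric_sum[OF h ST[OF e] ST])
      also have "\<dots> = (\<Sum>e'\<in>S. if e' = e then h p u e' else 0)"
        by (intro sum.cong refl) (simp add: ortho e)
      also have "\<dots> = h p u e" using fin e by simp
      finally show ?thesis
        unfolding r_def metric_add[OF h u tangent_space_scale[OF s] ST[OF e]] metric_scale[OF h s ST[OF e]]
        by simp
    qed
    have "r = (\<lambda>_. 0)"
    proof (rule ccontr)
      assume "r \<noteq> (\<lambda>_. 0)"
      then have c: "h p r r > 0" by (rule metric_pos[OF h r])
      define k where "k = 1 / sqrt (h p r r)"
      define n where "n = (\<lambda>f. k * r f)"
      have n: "n \<in> tangent_space V A p" unfolding n_def by (rule tangent_space_scale[OF r])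
      have ne: "h p n e = 0" if "e \<in> S" for e
        unfolding n_def by (simp add: metric_scale[OF h r ST[OF that]] re[OF that])
      then have en: "h p e n = 0" if "e \<in> S" for e
        using that metric_sym[OF h ST[OF that] n] by simp
      have "h p n n = k * h p n r"
        using metric_scale[OF h r n, of k] metric_sym[OF h r n] unfolding n_def by simp
      also have "h p n r = k * h p r r" unfolding n_def by (rule metric_scale[OF h r r])
      finally have nn: "h p n n = 1" using c by (simp add: k_def)
      then have "n \<notin> S" using ne by force
      then have "orthonormal_tangent h p (insert n S)"
        using fin ST n ortho ne en nn unfolding orthonormal_tangent_def by auto
      then show False using max[of "insert n S"] fin \<open>n \<notin> S\<close> by simp
    qed
    then have "r f = 0" by simp
    then show ?thesis by (simp add: r_def s_def)
  qed
  with S show ?thesis by (intro exI[of _ S]) simp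
qed

section \<open>Vector fields and the Lie bracket\<close>

lemma field_tangent: "X \<in> smooth_vector_fields V A \<Longrightarrow> X p \<in> tangent_space V A p"
  by (simp add: smooth_vector_fields_def)

lemma field_smooth:
  "X \<in> smooth_vector_fields V A \<Longrightarrow> f \<in> smooth_functions V A \<Longrightarrow> (\<lambda>p. X p f) \<in> smooth_functions V A"
  by (simp add: smooth_vector_fields_def)

lemma metric_smooth:
  assumes "riemannian_metric V A h" "X \<in> smooth_vector_fields V A" "Y \<in> smooth_vector_fields V A"
  shows "(\<lambda>p. h p (X p) (Y p)) \<in> smooth_functions V A"
  using assms unfolding riemannian_metric_def by blast

text \<open>
  In the Leibniz rule for the bracket, the mixed terms \<open>X f * Y g\<close> and \<open>Y f * X g\<close> cancel.
\<close>

lemma lie_bracket_field: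
  assumes X: "X \<in> smooth_vector_fields V A" and Y: "Y \<in> smooth_vector_fields V A"
  shows "lie_bracket X Y \<in> smooth_vector_fields V A"
proof -
  note XT = field_tangent[OF X] and YT = field_tangent[OF Y]
  note XS = field_smooth[OF X] and YS = field_smooth[OF Y]
  have "lie_bracket X Y p \<in> tangent_space V A p" for p
  proof (rule tangent_spaceI)
    fix f g assume f: "f \<in> smooth_functions V A" and g: "g \<in> smooth_functions V A"
    show "lie_bracket X Y p (\<lambda>q. f q + g q) = lie_bracket X Y p f + lie_bracket X Y p g"
      unfolding lie_bracket_def
      by (simp add: tangent_add[OF XT f g] tangent_add[OF YT f g]
          tangent_add[OF XT YS[OF f] YS[OF g]] tangent_add[OF YT XS[OF f] XS[OF g]])
    show "lie_bracket X Y p (\<lambda>q. f q * g q) = f p * lie_bracket X Y p g + g p * lie_bracket X Y p f"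
      unfolding lie_bracket_def
      by (simp add: tangent_mult[OF XT f g] tangent_mult[OF YT f g]
          tangent_add[OF XT smooth_functions_mult[OF f YS[OF g]] smooth_functions_mult[OF g YS[OF f]]]
          tangent_add[OF YT smooth_functions_mult[OF f XS[OF g]] smooth_functions_mult[OF g XS[OF f]]]
          tangent_mult[OF XT f YS[OF g]] tangent_mult[OF XT g YS[OF f]]
          tangent_mult[OF YT f XS[OF g]] tangent_mult[OF YT g XS[OF f]] algebra_simps)
  next
    fix f c assume f: "f \<in> smooth_functions V A"
    show "lie_bracket X Y p (\<lambda>q. c * f q) = c * lie_bracket X Y p f"
      unfolding lie_bracket_def
      by (simp add: tangent_scale[OF XT f] tangent_scale[OF YT f]
          tangent_scale[OF XT YS[OF f]] tangent_scale[OF YT XS[OF f]] algebra_simps)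
  next
    fix f assume f: "f \<notin> smooth_functions V A"
    show "lie_bracket X Y p f = 0"
      unfolding lie_bracket_def
      by (simp add: tangent_not_smooth[OF XT f] tangent_not_smooth[OF YT f]
          tangent_const[OF XT] tangent_const[OF YT])
  qed
  moreover have "(\<lambda>p. lie_bracket X Y p f) \<in> smooth_functions V A" if f: "f \<in> smooth_functions V A" for f
    using smooth_functions_add[OF XS[OF YS[OF f]]
        smooth_functions_mult[OF smooth_functions_const[of "- 1"] YS[OF XS[OF f]]]]
    by (simp add: lie_bracket_def)
  ultimately show ?thesis by (simp add: smooth_vector_fields_def)
qed

end

section \<open>Left-invariant vector fields\<close>

context lie_group
begin

text \<open>
  Smoothness of the multiplication is given separately for each chart of the target. Near a given
  pair of points the product stays in one such chart, and smoothness is a local property.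
\<close>

lemma smooth_mul_in_charts:
  assumes f: "f \<in> smooth_functions V A" and chart: "(U, \<phi>) \<in> A" and chart': "(U', \<psi>) \<in> A"
  shows "smooth_on (V \<times> V) (\<phi> ` U \<times> \<psi> ` U')
    (\<lambda>z. f (mul (inv_into U \<phi> (fst z)) (inv_into U' \<psi> (snd z))))" (is "smooth_on _ ?W ?F")
proof (rule smooth_onI, rule Ck_on_local)
  show W: "openin (top_of_set (V \<times> V)) ?W"
    by (intro openin_Times chart_image_open chart chart')
  show "subspace (V \<times> V)" by (intro subspace_Times subspace_model)
  fix k z assume z: "z \<in> ?W"
  let ?m = "\<lambda>(a, b). mul a b"
  let ?G = "\<lambda>z. ?m (inv_into U \<phi> (fst z), inv_into U' \<psi> (snd z))"
  have cont_m: "continuous_on UNIV ?m" using smooth_mul by (simp add: smooth_map_def)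
  have "continuous_on ?W ?G"
    by (intro continuous_on_compose2[OF cont_m] continuous_intros
        continuous_on_compose2[OF continuous_on_inv_chart[OF chart]]
        continuous_on_compose2[OF continuous_on_inv_chart[OF chart']]) auto
  obtain a b where ab: "a \<in> U" "b \<in> U'" "z = (\<phi> a, \<psi> b)" using z by auto
  obtain U'' \<theta> where chart'': "(U'', \<theta>) \<in> A" and in'': "mul a b \<in> U''" by (rule chart_at)
  have "openin (top_of_set ?W) (?W \<inter> ?G -` U'')"
    by (rule continuous_openin_preimage_gen[OF \<open>continuous_on ?W ?G\<close> chart_open[OF chart'']])
  then obtain T where T: "open T" "?W \<inter> ?G -` U'' = ?W \<inter> T" by (auto simp: openin_open)
  have "z \<in> T" using T(2) z ab in'' by (auto simp: inv_chart[OF chart] inv_chart[OF chart'])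
  have inv: "inv_into (U \<times> U') (map_prod \<phi> \<psi>) (\<phi> a, \<psi> b) = (a, b)" if "a \<in> U" "b \<in> U'" for a b
  proof -
    have "inj_on (map_prod \<phi> \<psi>) (U \<times> U')"
      by (intro map_prod_inj_on inj_on_inverseI[where g = "inv_into U \<phi>"]
          inj_on_inverseI[where g = "inv_into U' \<psi>"] inv_chart chart chart')
    from inv_into_f_f[OF this, of "(a, b)"] that show ?thesis by simp
  qed
  have "(U \<times> U', map_prod \<phi> \<psi>) \<in> product_atlas A A"
    using chart chart' by (auto simp: product_atlas_def)
  then have "smooth_on (V \<times> V) (map_prod \<phi> \<psi> ` (U \<times> U' \<inter> ?m -` U''))
      (\<theta> \<circ> ?m \<circ> inv_into (U \<times> U') (map_prod \<phi> \<psi>))"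
    using smooth_mul chart'' unfolding smooth_map_def by fast
  then have "Ck_on k (V \<times> V) (?W \<inter> T) (\<theta> \<circ> ?m \<circ> inv_into (U \<times> U') (map_prod \<phi> \<psi>))"
  proof (rule Ck_on_subset[OF smooth_onD], intro subsetI)
    fix y assume "y \<in> ?W \<inter> T"
    then have "y \<in> ?W \<inter> ?G -` U''" using T(2) by simp
    then obtain c d where "c \<in> U" "d \<in> U'" "y = (\<phi> c, \<psi> d)" "mul c d \<in> U''"
      by (auto simp: inv_chart[OF chart] inv_chart[OF chart'])
    then show "y \<in> map_prod \<phi> \<psi> ` (U \<times> U' \<inter> ?m -` U'')"
      by (intro image_eqI[of _ _ "(c, d)"]) auto
  qed
  then have "Ck_on k (V \<times> V) (?W \<inter> T)
      (\<lambda>y. (f \<circ> inv_into U'' \<theta>) ((\<theta> \<circ> ?m \<circ> inv_into (U \<times> U') (map_prod \<phi> \<psi>)) y))"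
  proof (rule Ck_on_compose[OF _ smooth_onD[OF smooth_functionsD[OF f chart'']]])
    show "(\<theta> \<circ> ?m \<circ> inv_into (U \<times> U') (map_prod \<phi> \<psi>)) ` (?W \<inter> T) \<subseteq> \<theta> ` U''"
      unfolding T(2)[symmetric] by (auto simp: inv inv_chart[OF chart] inv_chart[OF chart'])
  qed (simp_all add: chart_image_subset[OF chart''] subspace_model)
  then have "Ck_on k (V \<times> V) (?W \<inter> T) ?F"
  proof (rule Ck_on_cong)
    fix y assume "y \<in> ?W \<inter> T"
    then have "y \<in> ?W \<inter> ?G -` U''" using T(2) by simp
    then obtain c d where "c \<in> U" "d \<in> U'" "y = (\<phi> c, \<psi> d)" "mul c d \<in> U''"
      by (auto simp: inv_chart[OF chart] inv_chart[OF chart'])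
    then show "?F y = (f \<circ> inv_into U'' \<theta>) ((\<theta> \<circ> ?m \<circ> inv_into (U \<times> U') (map_prod \<phi> \<psi>)) y)"
      by (simp add: inv inv_chart[OF chart] inv_chart[OF chart'] inv_chart[OF chart''])
  qed
  then show "\<exists>T. open T \<and> z \<in> T \<and> Ck_on k (V \<times> V) (?W \<inter> T) ?F"
    using \<open>open T\<close> \<open>z \<in> T\<close> by blast
qed

lemma smooth_functions_translate:
  assumes f: "f \<in> smooth_functions V A"
  shows "(\<lambda>q. f (mul a q)) \<in> smooth_functions V A"
proof -
  obtain U \<phi> where chart: "(U, \<phi>) \<in> A" and a: "a \<in> U" by (rule chart_at)
  have "smooth_on V (\<psi> ` U') ((\<lambda>q. f (mul a q)) \<circ> inv_into U' \<psi>)" if chart': "(U', \<psi>) \<in> A" for U' \<psi>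
  proof (rule smooth_onI)
    fix k
    \<comment> \<open>the affine inclusion \<open>y \<mapsto> (\<phi> a, y)\<close> as a linear map plus a constant\<close>
    have "Ck_on k V (\<psi> ` U') (\<lambda>y. (0, y) + (\<phi> a, 0))"
      by (intro Ck_on_add Ck_on_const Ck_on_bounded_linear bounded_linear_Pair
          bounded_linear_zero bounded_linear_ident)
    then have "Ck_on k V (\<psi> ` U') (\<lambda>y. (\<phi> a, y))" by (rule Ck_on_cong) simp
    then have "Ck_on k V (\<psi> ` U')
        (\<lambda>y. f (mul (inv_into U \<phi> (fst (\<phi> a, y))) (inv_into U' \<psi> (snd (\<phi> a, y)))))"
      by (rule Ck_on_compose[OF _ smooth_onD[OF smooth_mul_in_charts[OF f chart chart']]])
        (use a chart_image_subset[OF chart] chart_image_subset[OF chart'] subspace_model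
          in \<open>auto intro!: subspace_Times\<close>)
    then show "Ck_on k V (\<psi> ` U') ((\<lambda>q. f (mul a q)) \<circ> inv_into U' \<psi>)"
      by (rule Ck_on_cong) (simp add: inv_chart[OF chart a])
  qed
  then show ?thesis by (auto simp: smooth_functions_def)
qed

lemma differential_translate:
  "f \<in> smooth_functions V A \<Longrightarrow> differential V A (mul a) v f = v (\<lambda>q. f (mul a q))"
  by (simp add: differential_def o_def)

lemma differential_translate_tangent:
  assumes v: "v \<in> tangent_space V A p"
  shows "differential V A (mul a) v \<in> tangent_space V A (mul a p)"
proof (rule tangent_spaceI)
  fix f g assume f: "f \<in> smooth_functions V A" and g: "g \<in> smooth_functions V A"
  show "differential V A (mul a) v (\<lambda>q. f q + g q) =
      differential V A (mul a) v f + differential V A (mul a) v g"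
    unfolding differential_translate[OF f] differential_translate[OF g]
      differential_translate[OF smooth_functions_add[OF f g]]
    by (rule tangent_add[OF v smooth_functions_translate[OF f] smooth_functions_translate[OF g]])
  show "differential V A (mul a) v (\<lambda>q. f q * g q) =
      f (mul a p) * differential V A (mul a) v g + g (mul a p) * differential V A (mul a) v f"
    unfolding differential_translate[OF f] differential_translate[OF g]
      differential_translate[OF smooth_functions_mult[OF f g]]
    by (rule tangent_mult[OF v smooth_functions_translate[OF f] smooth_functions_translate[OF g]])
next
  fix f c assume f: "f \<in> smooth_functions V A"
  show "differential V A (mul a) v (\<lambda>q. c * f q) = c * differential V A (mul a) v f"
    unfolding differential_translate[OF f]
      differential_translate[OF smooth_functions_mult[OF smooth_functions_const[of c] f]]
    by (rule tangent_scale[OF v smooth_functions_translate[OF f]])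
qed (simp add: differential_def)

definition left_extension :: "'g tangent_vector \<Rightarrow> 'g vector_field" where
  "left_extension v p = differential V A (mul p) v"

text \<open>
  In charts, \<open>v\<close> is a directional derivative along some \<open>w\<close>, so \<open>v (\<lambda>q. f (mul p q))\<close> is the partial
  derivative along \<open>(0, w)\<close> of the smooth function \<open>f (mul p q)\<close> of two variables, restricted to
  \<open>q = one\<close>.
\<close>

lemma left_extension_smooth:
  assumes v: "v \<in> tangent_space V A one" and f: "f \<in> smooth_functions V A"
  shows "(\<lambda>p. v (\<lambda>q. f (mul p q))) \<in> smooth_functions V A"
proof -
  obtain U' \<psi> where chart': "(U', \<psi>) \<in> A" and one: "one \<in> U'" by (rule chart_at)
  obtain w where w: "w \<in> V" "\<forall>g\<in>smooth_functions V A.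
      v g = frechet_derivative (g \<circ> inv_into U' \<psi>) (at (\<psi> one) within \<psi> ` U') w"
    using tangent_vector_is_directional_derivative[OF chart' one v] by (elim bexE)
  have "smooth_on V (\<phi> ` U) ((\<lambda>p. v (\<lambda>q. f (mul p q))) \<circ> inv_into U \<phi>)" if chart: "(U, \<phi>) \<in> A" for U \<phi>
  proof (rule smooth_onI)
    fix k
    let ?W = "\<phi> ` U \<times> \<psi> ` U'"
    define F where "F z = f (mul (inv_into U \<phi> (fst z)) (inv_into U' \<psi> (snd z)))" for z
    have F: "smooth_on (V \<times> V) ?W F"
      unfolding F_def by (rule smooth_mul_in_charts[OF f chart chart'])
    have W: "openin (top_of_set (V \<times> V)) ?W"
      by (intro openin_Times chart_image_open chart chart')
    have VV: "subspace (V \<times> V)" by (intro subspace_Times subspace_model)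
    have w0: "(0, w) \<in> V \<times> V" using w(1) subspace_0[OF subspace_model] by simp
    let ?D = "\<lambda>z. frechet_derivative F (at z within ?W)"
    have "Ck_on k V (\<phi> ` U) (\<lambda>x. (x, 0) + (0, \<psi> one))"
      by (intro Ck_on_add Ck_on_const Ck_on_bounded_linear bounded_linear_Pair
          bounded_linear_zero bounded_linear_ident)
    then have "Ck_on k V (\<phi> ` U) (\<lambda>x. (x, \<psi> one))" by (rule Ck_on_cong) simp
    then have "Ck_on k V (\<phi> ` U) (\<lambda>x. ?D (x, \<psi> one) (0, w))"
      by (rule Ck_on_compose[OF _ smooth_onD[OF smooth_on_directional_derivative[OF F W VV w0]]])
        (use one chart_image_subset[OF chart] chart_image_subset[OF chart'] VV in auto)
    then show "Ck_on k V (\<phi> ` U) ((\<lambda>p. v (\<lambda>q. f (mul p q))) \<circ> inv_into U \<phi>)"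
    proof (rule Ck_on_cong)
      fix x assume x: "x \<in> \<phi> ` U"
      let ?g = "\<lambda>q. f (mul (inv_into U \<phi> x) q)"
      have g: "?g \<in> smooth_functions V A" by (rule smooth_functions_translate[OF f])
      have xo: "(x, \<psi> one) \<in> ?W" using x one by auto
      have "(F has_derivative ?D (x, \<psi> one)) (at (x, \<psi> one) within Pair x ` \<psi> ` U')"
        by (rule has_derivative_subset[OF smooth_on_has_derivative[OF F xo]]) (use x in auto)
      moreover have "(Pair x has_derivative (\<lambda>y. (0, y))) (at (\<psi> one) within \<psi> ` U')"
        by (auto intro!: derivative_eq_intros)
      ultimately have "((\<lambda>y. F (x, y)) has_derivative (\<lambda>y. ?D (x, \<psi> one) (0, y)))
          (at (\<psi> one) within \<psi> ` U')"
        by (rule has_derivative_in_compose[where f = "Pair x" and g = F, rotated])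
      moreover have "(\<lambda>y. F (x, y)) = ?g \<circ> inv_into U' \<psi>" by (simp add: F_def o_def)
      ultimately have "(?g \<circ> inv_into U' \<psi> has_derivative (\<lambda>y. ?D (x, \<psi> one) (0, y)))
          (at (\<psi> one) within \<psi> ` U')" by simp
      then have "?D (x, \<psi> one) (0, w) =
          frechet_derivative (?g \<circ> inv_into U' \<psi>) (at (\<psi> one) within \<psi> ` U') w"
        by (rule has_derivative_within_unique[OF _ smooth_on_has_derivative[OF
                smooth_functionsD[OF g chart'] imageI[OF one]]
              chart_image_open[OF chart'] subspace_model imageI[OF one] w(1)])
      then show "((\<lambda>p. v (\<lambda>q. f (mul p q))) \<circ> inv_into U \<phi>) x = ?D (x, \<psi> one) (0, w)"
        using bspec[OF w(2) g] by simp
    qed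
  qed
  then show ?thesis by (auto simp: smooth_functions_def)
qed

lemma left_extension_left_invariant:
  assumes v: "v \<in> tangent_space V A one"
  shows "left_extension v \<in> left_invariant_fields V A mul"
proof -
  have "left_extension v p \<in> tangent_space V A p" for p
    using differential_translate_tangent[OF v, of p] by (simp add: left_extension_def)
  moreover have "(\<lambda>p. left_extension v p f) \<in> smooth_functions V A" if "f \<in> smooth_functions V A" for f
    using left_extension_smooth[OF v that] by (simp add: left_extension_def differential_translate[OF that])
  moreover have "left_extension v (mul a p) = differential V A (mul a) (left_extension v p)" for a p
  proof
    fix f
    show "left_extension v (mul a p) f = differential V A (mul a) (left_extension v p) f"
    proof (cases "f \<in> smooth_functions V A")
      case True
      then show ?thesis
        by (simp add: left_extension_def differential_translate smooth_functions_translate assoc)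
    qed (simp add: left_extension_def differential_def)
  qed
  ultimately show ?thesis by (simp add: left_invariant_fields_def smooth_vector_fields_def)
qed

lemma left_extension_one:
  assumes v: "v \<in> tangent_space V A one"
  shows "left_extension v one = v"
proof
  fix f
  show "left_extension v one f = v f"
  proof (cases "f \<in> smooth_functions V A")
    case True
    then show ?thesis by (simp add: left_extension_def differential_translate)
  next
    case False
    then show ?thesis
      using tangent_not_smooth[OF v, of f] by (simp add: left_extension_def differential_def)
  qed
qed

lemma left_invariant_smooth:
  "X \<in> left_invariant_fields V A mul \<Longrightarrow> X \<in> smooth_vector_fields V A"
  by (simp add: left_invariant_fields_def)

lemma left_invariant_translate:
  "X \<in> left_invariant_fields V A mul \<Longrightarrow> X (mul a p) = differential V A (mul a) (X p)"
  by (simp add: left_invariant_fields_def)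

lemma lie_bracket_left_invariant:
  assumes X: "X \<in> left_invariant_fields V A mul" and Y: "Y \<in> left_invariant_fields V A mul"
  shows "lie_bracket X Y \<in> left_invariant_fields V A mul"
proof -
  note XS = left_invariant_smooth[OF X] and YS = left_invariant_smooth[OF Y]
  have "lie_bracket X Y (mul a p) f = differential V A (mul a) (lie_bracket X Y p) f" for a p f
  proof (cases "f \<in> smooth_functions V A")
    case True
    have "X (mul a p) (\<lambda>q. Y q f) = X p (\<lambda>q. Y q (\<lambda>r. f (mul a r)))"
      by (simp add: left_invariant_translate[OF X] left_invariant_translate[OF Y]
          differential_translate[OF field_smooth[OF YS True]] differential_translate[OF True])
    moreover have "Y (mul a p) (\<lambda>q. X q f) = Y p (\<lambda>q. X q (\<lambda>r. f (mul a r)))"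
      by (simp add: left_invariant_translate[OF X] left_invariant_translate[OF Y]
          differential_translate[OF field_smooth[OF XS True]] differential_translate[OF True])
    ultimately show ?thesis
      by (simp add: differential_translate[OF True] lie_bracket_def)
  next
    case False
    then show ?thesis
      using tangent_not_smooth[OF field_tangent[OF lie_bracket_field[OF XS YS]]]
      by (simp add: differential_def)
  qed
  then show ?thesis using lie_bracket_field[OF XS YS] by (auto simp: left_invariant_fields_def)
qed

lemma metric_left_invariant_const:
  assumes h: "left_invariant_metric V A mul h"
    and Y: "Y \<in> left_invariant_fields V A mul" and Z: "Z \<in> left_invariant_fields V A mul"
  shows "h q (Y q) (Z q) = h one (Y one) (Z one)"
proof -
  have "h (mul q one) (differential V A (mul q) (Y one)) (differential V A (mul q) (Z one)) =
      h one (Y one) (Z one)"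
    using h field_tangent[OF left_invariant_smooth[OF Y]] field_tangent[OF left_invariant_smooth[OF Z]]
    unfolding left_invariant_metric_def by blast
  then show ?thesis
    unfolding left_invariant_translate[OF Y, symmetric] left_invariant_translate[OF Z, symmetric] by simp
qed

section \<open>Left-invariant Killing fields are central\<close>

text \<open>
  The inner product of two left-invariant fields is constant, hence killed by \<open>\<xi>\<close>. What remains of
  the Killing equation is that the adjoint action of \<open>\<xi>\<close> is skew.
\<close>

lemma killing_skew:
  assumes h: "riemannian_metric V A h" "left_invariant_metric V A mul h"
    and \<xi>: "\<xi> \<in> left_invariant_fields V A mul" "\<xi> \<in> killing_fields V A h"
    and Y: "Y \<in> left_invariant_fields V A mul" and Z: "Z \<in> left_invariant_fields V A mul"
  shows "h p (lie_bracket \<xi> Y p) (Z p) = - h p (Y p) (lie_bracket \<xi> Z p)"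
proof -
  have "lie_derivative_metric \<xi> h Y Z = 0"
    using \<xi>(2) left_invariant_smooth[OF Y] left_invariant_smooth[OF Z] by (simp add: killing_fields_def)
  then have "lie_derivative_metric \<xi> h Y Z p = 0" by simp
  moreover have "(\<lambda>q. h q (Y q) (Z q)) = (\<lambda>_. h one (Y one) (Z one))"
    by (rule ext) (rule metric_left_invariant_const[OF h(2) Y Z])
  then have "\<xi> p (\<lambda>q. h q (Y q) (Z q)) = 0"
    using tangent_const[OF field_tangent[OF left_invariant_smooth[OF \<xi>(1)]]] by (simp only:)
  ultimately show ?thesis by (simp add: lie_derivative_metric_def)
qed

lemma iterated_bracket_left_invariant:
  assumes "\<xi> \<in> left_invariant_fields V A mul" "Y \<in> left_invariant_fields V A mul"
  shows "(lie_bracket \<xi> ^^ k) Y \<in> left_invariant_fields V A mul"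
  by (induction k) (simp_all add: assms lie_bracket_left_invariant)

lemma iterated_bracket_lower_central_series:
  assumes "\<xi> \<in> left_invariant_fields V A mul" "Y \<in> left_invariant_fields V A mul"
  shows "(lie_bracket \<xi> ^^ k) Y \<in> lower_central_series V A mul k"
proof (induction k)
  case (Suc k)
  have "module (\<lambda>(c::real) (X::'g vector_field) p f. c * X p f)"
    by unfold_locales (auto simp: fun_eq_iff algebra_simps)
  then show ?case using Suc assms(1) by (auto intro!: module.span_base)
qed (use assms in simp)

text \<open>
  The adjoint action \<open>ad\<close> of \<open>\<xi>\<close> is nilpotent and skew, and such an operator vanishes: if
  \<open>ad\<^sup>2 Z = 0\<close>, then \<open>h (ad Z, ad Z) = - h (Z, ad\<^sup>2 Z) = 0\<close>, so \<open>ad Z = 0\<close>. Applied to \<open>Z = ad\<^sup>j Y\<close>, this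
  lowers the exponent step by step down to \<open>1\<close>.
\<close>

lemma killing_imp_central:
  assumes h: "riemannian_metric V A h" "left_invariant_metric V A mul h"
    and nil: "nilpotent_lie_group V A mul"
    and \<xi>: "\<xi> \<in> left_invariant_fields V A mul" "\<xi> \<in> killing_fields V A h"
    and Y: "Y \<in> left_invariant_fields V A mul"
  shows "lie_bracket \<xi> Y = 0"
proof -
  let ?ad = "\<lambda>k. (lie_bracket \<xi> ^^ k) Y"
  note ad = iterated_bracket_left_invariant[OF \<xi>(1) Y]
  have \<xi>T: "\<xi> p \<in> tangent_space V A p" for p
    using field_tangent[OF left_invariant_smooth[OF \<xi>(1)]] .
  obtain k where "lower_central_series V A mul k = {0}"
    using nil by (auto simp: nilpotent_lie_group_def)
  then have "?ad k = 0" using iterated_bracket_lower_central_series[OF \<xi>(1) Y, of k] by simp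
  \<comment> \<open>one step beyond \<open>k\<close>, so that the exponent is positive also for \<open>k = 0\<close>\<close>
  then have "?ad (Suc k) = 0"
    by (auto simp: lie_bracket_def fun_eq_iff tangent_const[OF \<xi>T])
  moreover have "?ad (Suc j) = 0 \<Longrightarrow> ?ad (Suc 0) = 0" for j
  proof (induction j)
    case (Suc j)
    have "?ad (Suc j) p = (\<lambda>_. 0)" for p
    proof (rule ccontr)
      assume "?ad (Suc j) p \<noteq> (\<lambda>_. 0)"
      then have "h p (?ad (Suc j) p) (?ad (Suc j) p) > 0"
        by (rule metric_pos[OF h(1) field_tangent[OF left_invariant_smooth[OF ad]]])
      moreover have "h p (?ad (Suc j) p) (?ad (Suc j) p) = - h p (?ad j p) (?ad (Suc (Suc j)) p)"
        using killing_skew[OF h \<xi> ad[of j] ad[of "Suc j"]] by simp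
      moreover have "h p (?ad j p) (?ad (Suc (Suc j)) p) = h p (\<lambda>_. 0) (?ad j p)"
        unfolding Suc.prems
        using metric_sym[OF h(1) tangent_space_zero field_tangent[OF left_invariant_smooth[OF ad]], of p j]
        by (simp add: zero_fun_def)
      moreover have "h p (\<lambda>_. 0) (?ad j p) = 0"
        by (rule metric_zero[OF h(1) field_tangent[OF left_invariant_smooth[OF ad]]])
      ultimately show False by simp
    qed
    then have "?ad (Suc j) = 0" by (auto simp: fun_eq_iff)
    then show ?case by (rule Suc.IH)
  qed
  ultimately show ?thesis by simp
qed

section \<open>Central left-invariant fields are Killing\<close>

text \<open>
  The frame consists of the left-invariant extensions of an orthonormal basis at \<open>one\<close>. Left
  translation by the inverse of \<open>p\<close> is an isometry from the tangent space at \<open>p\<close> to that at \<open>one\<close>,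
  which carries the frame to the basis.
\<close>

lemma left_invariant_frame:
  assumes h: "riemannian_metric V A h" "left_invariant_metric V A mul h"
  shows "\<exists>S\<subseteq>left_invariant_fields V A mul.
    \<forall>p. \<forall>u\<in>tangent_space V A p. \<forall>f. u f = (\<Sum>E\<in>S. h p u (E p) * E p f)"
proof -
  obtain B where basis: "orthonormal_tangent h one B \<and>
      (\<forall>u\<in>tangent_space V A one. \<forall>f. u f = (\<Sum>e\<in>B. h one u e * e f))"
    using orthonormal_tangent_basis[OF h(1), of one] by (rule exE)
  have expand: "u f = (\<Sum>e\<in>B. h one u e * e f)" if "u \<in> tangent_space V A one" for u f
    using basis that by simp
  have BT: "\<And>e. e \<in> B \<Longrightarrow> e \<in> tangent_space V A one"
    using conjunct1[OF basis] by (auto simp: orthonormal_tangent_def)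
  note L = left_extension_left_invariant[OF BT]
  have inj: "inj_on left_extension B"
    by (rule inj_on_inverseI[where g = "\<lambda>X. X one"]) (simp add: left_extension_one BT)
  have "u f = (\<Sum>e\<in>B. h p u (left_extension e p) * left_extension e p f)"
    if u: "u \<in> tangent_space V A p" for p u f
  proof (cases "f \<in> smooth_functions V A")
    case True
    let ?t = "mul (ginv p)"
    let ?u = "differential V A ?t u"
    have u': "?u \<in> tangent_space V A one"
      using differential_translate_tangent[OF u, of "ginv p"] by simp
    have "u f = ?u (\<lambda>q. f (mul p q))"
      by (simp add: differential_translate[OF smooth_functions_translate[OF True]] flip: assoc)
    also have "\<dots> = (\<Sum>e\<in>B. h one ?u e * e (\<lambda>q. f (mul p q)))" by (rule expand[OF u'])
    also have "\<dots> = (\<Sum>e\<in>B. h p u (left_extension e p) * left_extension e p f)"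
    proof (rule sum.cong[OF refl])
      fix e assume e: "e \<in> B"
      have "h (?t p) ?u (differential V A ?t (left_extension e p)) = h p u (left_extension e p)"
        using h(2) u field_tangent[OF left_invariant_smooth[OF L[OF e]]]
        unfolding left_invariant_metric_def by blast
      moreover have "differential V A ?t (left_extension e p) = e"
        using left_invariant_translate[OF L[OF e], of "ginv p" p] left_extension_one[OF BT[OF e]] by simp
      ultimately show "h one ?u e * e (\<lambda>q. f (mul p q)) = h p u (left_extension e p) * left_extension e p f"
        by (simp add: left_extension_def differential_translate[OF True])
    qed
    finally show ?thesis .
  next
    case False
    then show ?thesis by (simp add: tangent_not_smooth[OF u] left_extension_def differential_def)
  qed
  then show ?thesis
    using L by (intro exI[of _ "left_extension ` B"]) (auto simp: sum.reindex[OF inj])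
qed

text \<open>
  The fields \<open>Y\<close> and \<open>Z\<close> in the Killing equation need not be left-invariant. Over an orthonormal
  left-invariant frame they have smooth coefficients \<open>y\<^sub>E = h (Y, E)\<close> and \<open>z\<^sub>E = h (Z, E)\<close>. As \<open>\<xi>\<close>
  commutes with the frame, \<open>[\<xi>, Y] = (\<Sum>E. \<xi> y\<^sub>E * E)\<close>, and \<open>\<xi> (h (Y, Z)) = \<xi> (\<Sum>E. y\<^sub>E * z\<^sub>E)\<close>, so the
  Killing equation is the product rule for the coefficients.
\<close>

lemma central_imp_killing:
  assumes h: "riemannian_metric V A h" "left_invariant_metric V A mul h"
    and \<xi>: "\<xi> \<in> left_invariant_fields V A mul"
    and central: "\<And>v. v \<in> left_invariant_fields V A mul \<Longrightarrow> lie_bracket \<xi> v = 0"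
  shows "\<xi> \<in> killing_fields V A h"
proof -
  obtain S where S: "S \<subseteq> left_invariant_fields V A mul"
    and frame: "\<forall>p. \<forall>u\<in>tangent_space V A p. \<forall>f. u f = (\<Sum>E\<in>S. h p u (E p) * E p f)"
    using left_invariant_frame[OF h] by (elim exE conjE)
  have expand: "u f = (\<Sum>E\<in>S. h p u (E p) * E p f)" if "u \<in> tangent_space V A p" for u p f
    using frame that by simp
  have \<xi>S: "\<xi> \<in> smooth_vector_fields V A" by (rule left_invariant_smooth[OF \<xi>])
  note \<xi>T = field_tangent[OF \<xi>S]
  have ES: "E \<in> smooth_vector_fields V A" if "E \<in> S" for E
    using left_invariant_smooth[of E] S that by auto
  note ET = field_tangent[OF ES]
  have coeff: "(\<lambda>q. h q (Y q) (E q)) \<in> smooth_functions V A"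
    if "Y \<in> smooth_vector_fields V A" "E \<in> S" for Y E
    by (rule metric_smooth[OF h(1) that(1) ES[OF that(2)]])
  have commute: "\<xi> p (\<lambda>q. E q f) = E p (\<lambda>q. \<xi> q f)" if "E \<in> S" for E p f
  proof -
    have "lie_bracket \<xi> E p f = 0" using central[of E] S that by auto
    then show ?thesis by (simp add: lie_bracket_def)
  qed
  have bracket: "lie_bracket \<xi> Y p f = (\<Sum>E\<in>S. \<xi> p (\<lambda>q. h q (Y q) (E q)) * E p f)"
    if Y: "Y \<in> smooth_vector_fields V A" for Y p f
  proof (cases "f \<in> smooth_functions V A")
    case True
    have "\<xi> p (\<lambda>q. Y q f) = \<xi> p (\<lambda>q. \<Sum>E\<in>S. h q (Y q) (E q) * E q f)"
      by (rule arg_cong[where f = "\<xi> p"]) (rule ext, rule expand[OF field_tangent[OF Y]])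
    also have "\<dots> = (\<Sum>E\<in>S. \<xi> p (\<lambda>q. h q (Y q) (E q) * E q f))"
      by (intro tangent_sum[OF \<xi>T] smooth_functions_mult coeff[OF Y] field_smooth[OF ES True])
    also have "\<dots> = (\<Sum>E\<in>S. h p (Y p) (E p) * E p (\<lambda>q. \<xi> q f) + E p f * \<xi> p (\<lambda>q. h q (Y q) (E q)))"
      by (intro sum.cong refl)
        (simp add: tangent_mult[OF \<xi>T coeff[OF Y] field_smooth[OF ES True]] commute)
    also have "\<dots> = Y p (\<lambda>q. \<xi> q f) + (\<Sum>E\<in>S. \<xi> p (\<lambda>q. h q (Y q) (E q)) * E p f)"
      unfolding expand[OF field_tangent[OF Y], of p "\<lambda>q. \<xi> q f"]
      by (simp add: sum.distrib mult.commute)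
    finally show ?thesis by (simp add: lie_bracket_def)
  next
    case False
    then show ?thesis
      by (simp add: tangent_not_smooth[OF ET] tangent_not_smooth[OF field_tangent[OF lie_bracket_field[OF \<xi>S Y]]])
  qed
  have "lie_derivative_metric \<xi> h Y Z p = 0"
    if Y: "Y \<in> smooth_vector_fields V A" and Z: "Z \<in> smooth_vector_fields V A" for Y Z p
  proof -
    note YT = field_tangent[OF Y] and ZT = field_tangent[OF Z]
    let ?y = "\<lambda>E q. h q (Y q) (E q)" and ?z = "\<lambda>E q. h q (Z q) (E q)"
    have half: "h p (lie_bracket \<xi> Y p) (Z p) = (\<Sum>E\<in>S. \<xi> p (\<lambda>q. h q (Y q) (E q)) * h p (Z p) (E p))"
      if Y: "Y \<in> smooth_vector_fields V A" and Z: "Z \<in> smooth_vector_fields V A" for Y Z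
    proof -
      have "h p (lie_bracket \<xi> Y p) (Z p) = h p (\<lambda>f. \<Sum>E\<in>S. \<xi> p (\<lambda>q. h q (Y q) (E q)) * E p f) (Z p)"
        by (rule arg_cong[where f = "\<lambda>u. h p u (Z p)"]) (rule ext, rule bracket[OF Y])
      also have "\<dots> = (\<Sum>E\<in>S. \<xi> p (\<lambda>q. h q (Y q) (E q)) * h p (E p) (Z p))"
        by (rule metric_sum[OF h(1) field_tangent[OF Z] ET])
      finally show ?thesis
        by (simp add: metric_sym[OF h(1) field_tangent[OF Z] ET] cong: sum.cong)
    qed
    have inner: "h q (Y q) (Z q) = (\<Sum>E\<in>S. ?y E q * ?z E q)" for q
    proof -
      have "h q (Y q) (Z q) = h q (\<lambda>f. \<Sum>E\<in>S. ?y E q * E q f) (Z q)"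
        by (rule arg_cong[where f = "\<lambda>u. h q u (Z q)"]) (rule ext, rule expand[OF YT])
      also have "\<dots> = (\<Sum>E\<in>S. ?y E q * h q (E q) (Z q))"
        by (rule metric_sum[OF h(1) ZT ET])
      finally show ?thesis by (simp add: metric_sym[OF h(1) ZT ET] cong: sum.cong)
    qed
    have "\<xi> p (\<lambda>q. h q (Y q) (Z q)) = (\<Sum>E\<in>S. \<xi> p (\<lambda>q. ?y E q * ?z E q))"
      unfolding inner by (intro tangent_sum[OF \<xi>T] smooth_functions_mult coeff Y Z)
    also have "\<dots> = (\<Sum>E\<in>S. ?y E p * \<xi> p (?z E) + ?z E p * \<xi> p (?y E))"
      by (intro sum.cong refl tangent_mult[OF \<xi>T] coeff Y Z)
    also have "\<dots> = h p (lie_bracket \<xi> Z p) (Y p) + h p (lie_bracket \<xi> Y p) (Z p)"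
      unfolding half[OF Z Y] half[OF Y Z] by (simp add: sum.distrib mult.commute)
    also have "h p (lie_bracket \<xi> Z p) (Y p) = h p (Y p) (lie_bracket \<xi> Z p)"
      by (rule metric_sym[OF h(1) field_tangent[OF lie_bracket_field[OF \<xi>S Z]] YT])
    finally show ?thesis by (simp add: lie_derivative_metric_def)
  qed
  then show ?thesis using \<xi>S by (auto simp: killing_fields_def fun_eq_iff)
qed

end

theorem theorem1:
  fixes V :: "'e::euclidean_space set"
    and A :: "('g::{t2_space, second_countable_topology}, 'e) atlas"
    and mul :: "'g \<Rightarrow> 'g \<Rightarrow> 'g" and one :: 'g and ginv :: "'g \<Rightarrow> 'g"
    and h :: "'g metric_tensor" and n :: nat
  assumes "lie_group V A mul one ginv"
    and "dim V = n"
    and "simply_connected (UNIV :: 'g set)"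
    and "nilpotent_lie_group V A mul"
    and "riemannian_metric V A h"
    and "left_invariant_metric V A mul h"
  shows "left_invariant_fields V A mul \<inter> killing_fields V A h =
    {\<xi> \<in> left_invariant_fields V A mul. \<forall>v\<in>left_invariant_fields V A mul. lie_bracket \<xi> v = 0}"
proof -
  interpret lie_group V A mul one ginv by (rule assms(1))
  have "\<xi> \<in> killing_fields V A h \<longleftrightarrow> (\<forall>v\<in>left_invariant_fields V A mul. lie_bracket \<xi> v = 0)"
    if "\<xi> \<in> left_invariant_fields V A mul" for \<xi>
    using killing_imp_central[OF assms(5,6,4) that] central_imp_killing[OF assms(5,6) that] by metis
  then show ?thesis by auto
qed

end
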